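(* Let $(M,\varphi,\xi,\eta,g,\varepsilon)$ be a $3$-dimensional $(\varepsilon)$-para Sasakian manifold which is Ricci-semi-symmetric. Then $M$ is an indefinite space form.
   Context: All manifolds and tensor fields are smooth; $\mathfrak X(M)$ denotes the vector fields on $M$. An almost paracontact structure $(\varphi,\xi,\eta)$ on $M$ consists of a $(1,1)$-tensor field $\varphi$, a vector field $\xi$ and a $1$-form $\eta$ with $\varphi^2=I-\eta\otimes\xi$, $\eta(\xi)=1$, $\varphi\xi=0$, $\eta\circ\varphi=0$. A semi-Riemannian metric is a non-degenerate symmetric $(0,2)$-tensor field (of some constant index, arbitrary). If $g$ is a semi-Riemannian metric on $M$ with $g(\varphi X,\varphi Y)=g(X,Y)-\varepsilon\eta(X)\eta(Y)$ for all $X,Y\in\mathfrak X(M)$, where $\varepsilon\in\{1,-1\}$ is a constant, then $(M,\varphi,\xi,\eta,g,\varepsilon)$ is an $(\varepsilon)$-almost paracontact metric manifold. It is an $(\varepsilon)$-para Sasakian manifold if moreover $(\nabla_X\varphi)Y=-g(\varphi X,\varphi Y)\xi-\varepsilon\eta(Y)\varphi^2X$ for all $X,Y\in\mathfrak X(M)$, where $\nabla$ is the Levi-Civita connection of $g$. Curvature conventions: $R(X,Y)Z=\nabla_X\nabla_YZ-\nabla_Y\nabla_XZ-\nabla_{[X,Y]}Z$, and the Ricci tensor is $S(Y,Z)=\mathrm{trace}(X\mapsto R(X,Y)Z)$. $M$ is Ricci-semi-symmetric if $R(X,Y)\cdot S=0$ for all $X,Y\in\mathfrak X(M)$, where $R(X,Y)$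 acts as a derivation; that is, $S(R(X,Y)U,V)+S(U,R(X,Y)V)=0$ for all $X,Y,U,V\in\mathfrak X(M)$. $M$ is an indefinite space form if it has constant curvature, i.e. there is a constant $c\in\mathbb R$ with $R(X,Y)Z=c\{g(Y,Z)X-g(X,Z)Y\}$ for all $X,Y,Z\in\mathfrak X(M)$. *)

theory Defs
  imports "HOL-Analysis.Analysis" "HOL-Library.Function_Algebras"
begin

section \<open>Preliminaries\<close>

instantiation "fun" :: (type, real_vector) real_vector
begin

definition scaleR_fun :: "real \<Rightarrow> ('a \<Rightarrow> 'b) \<Rightarrow> 'a \<Rightarrow> 'b"
  where "scaleR_fun c f = (\<lambda>x. c *\<^sub>R f x)"

instance
  by standard (auto simp: scaleR_fun_def fun_eq_iff algebra_simps)

end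

lemma scaleR_fun_apply [simp]: "(c *\<^sub>R f) x = c *\<^sub>R f x"
  by (simp add: scaleR_fun_def)

text \<open>Only meant for open \<open>S\<close>: derivatives are the full derivatives \<open>at x\<close>, not \<open>at x within S\<close>.\<close>

primrec Ck_on :: "nat \<Rightarrow> 'b::real_normed_vector set \<Rightarrow> ('b \<Rightarrow> 'c::real_normed_vector) \<Rightarrow> bool" where
  "Ck_on 0 S f \<longleftrightarrow> continuous_on S f"
| "Ck_on (Suc k) S f \<longleftrightarrow>
     (\<forall>x\<in>S. f differentiable (at x)) \<and> (\<forall>v. Ck_on k S (\<lambda>x. frechet_derivative f (at x) v))"

definition smooth_on :: "'b::real_normed_vector set \<Rightarrow> ('b \<Rightarrow> 'c::real_normed_vector) \<Rightarrow> bool"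
  where "smooth_on S f \<longleftrightarrow> (\<forall>k. Ck_on k S f)"

definition linear_between ::
    "'b::real_vector set \<Rightarrow> 'c::real_vector set \<Rightarrow> ('b \<Rightarrow> 'c) \<Rightarrow> bool"
  where "linear_between V W f \<longleftrightarrow>
    f ` V \<subseteq> W \<and>
    (\<forall>v\<in>V. \<forall>w\<in>V. f (v + w) = f v + f w) \<and>
    (\<forall>c. \<forall>v\<in>V. f (c *\<^sub>R v) = c *\<^sub>R f v)"

text \<open>Trace of an endomorphism of a finite-dimensional subspace \<open>V\<close>; it does not depend on the
  basis chosen.\<close>

definition trace_on :: "'b::real_vector set \<Rightarrow> ('b \<Rightarrow> 'b) \<Rightarrow> real"
  where "trace_on V T =
    (let B = (SOME B. B \<subseteq> V \<and> independent B \<and> span B = V)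
     in \<Sum>b\<in>B. representation B (T b) b)"

text \<open>The index of a symmetric bilinear form on a finite-dimensional subspace \<open>V\<close>.\<close>

definition form_index :: "'b::real_vector set \<Rightarrow> ('b \<Rightarrow> 'b \<Rightarrow> real) \<Rightarrow> nat"
  where "form_index V b =
    Max {dim W | W. subspace W \<and> W \<subseteq> V \<and> (\<forall>w\<in>W. w \<noteq> 0 \<longrightarrow> b w w < 0)}"


section \<open>Smooth manifolds, functions and vector fields\<close>

text \<open>The underlying space of a manifold is the whole type \<open>'a\<close>; a chart is a pair of an open
  domain and a coordinate map, whose values off the domain are irrelevant.\<close>

type_synonym ('a, 'e) atlas = "('a set \<times> ('a \<Rightarrow> 'e)) set"

locale smooth_manifold =
  fixes A :: "('a::{t2_space,second_countable_topology}, 'e::euclidean_space) atlas"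
  assumes chart: "(U, \<psi>) \<in> A \<Longrightarrow>
      open U \<and> open (\<psi> ` U) \<and> homeomorphism U (\<psi> ` U) \<psi> (inv_into U \<psi>)"
    and cover: "(\<Union>(U, \<psi>)\<in>A. U) = UNIV"
    and compatible: "(U, \<psi>) \<in> A \<Longrightarrow> (V, \<theta>) \<in> A \<Longrightarrow>
      smooth_on (\<psi> ` (U \<inter> V)) (\<theta> \<circ> inv_into U \<psi>)"

definition smooth_functions ::
    "('a::topological_space, 'e::euclidean_space) atlas \<Rightarrow> ('a \<Rightarrow> real) set"
  where "smooth_functions A = {f. \<forall>(U, \<psi>)\<in>A. smooth_on (\<psi> ` U) (f \<circ> inv_into U \<psi>)}"

text \<open>Tangent vectors at \<open>p\<close> are the derivations at \<open>p\<close> of the algebra of smooth functions.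
  Since functions are total, they are normalised to vanish on non-smooth functions, so that equality
  of tangent vectors is equality as derivations of the smooth functions.\<close>

type_synonym 'a tvec = "('a \<Rightarrow> real) \<Rightarrow> real"

definition tangent_space ::
    "('a::topological_space, 'e::euclidean_space) atlas \<Rightarrow> 'a \<Rightarrow> 'a tvec set"
  where "tangent_space A p = {v.
    (\<forall>f. f \<notin> smooth_functions A \<longrightarrow> v f = 0) \<and>
    linear_between (smooth_functions A) UNIV v \<and>
    (\<forall>f\<in>smooth_functions A. \<forall>h\<in>smooth_functions A. v (f * h) = f p * v h + h p * v f)}"

type_synonym 'a vfield = "'a \<Rightarrow> 'a tvec"

definition vderiv :: "'a vfield \<Rightarrow> ('a \<Rightarrow> real) \<Rightarrow> 'a \<Rightarrow> real"
  where "vderiv X f = (\<lambda>p. X p f)"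

definition vector_fields ::
    "('a::topological_space, 'e::euclidean_space) atlas \<Rightarrow> 'a vfield set"
  where "vector_fields A = {X.
    (\<forall>p. X p \<in> tangent_space A p) \<and>
    (\<forall>f\<in>smooth_functions A. vderiv X f \<in> smooth_functions A)}"

definition fmul :: "('a \<Rightarrow> real) \<Rightarrow> 'a vfield \<Rightarrow> 'a vfield"  (infixr "\<odot>" 75)
  where "f \<odot> X = (\<lambda>p. f p *\<^sub>R X p)"

definition lie_bracket :: "'a vfield \<Rightarrow> 'a vfield \<Rightarrow> 'a vfield"
  where "lie_bracket X Y = (\<lambda>p f. X p (vderiv Y f) - Y p (vderiv X f))"


section \<open>Tensor fields\<close>

text \<open>Tensor fields are given pointwise; their values at arguments outside the tangent spaces are
  irrelevant. They act on vector fields as follows.\<close>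

type_synonym 'a endo_field = "'a \<Rightarrow> 'a tvec \<Rightarrow> 'a tvec"
type_synonym 'a one_form = "'a \<Rightarrow> 'a tvec \<Rightarrow> real"
type_synonym 'a bilinear_field = "'a \<Rightarrow> 'a tvec \<Rightarrow> 'a tvec \<Rightarrow> real"

definition app_endo :: "'a endo_field \<Rightarrow> 'a vfield \<Rightarrow> 'a vfield"
  where "app_endo \<phi> X = (\<lambda>p. \<phi> p (X p))"

definition app_form :: "'a one_form \<Rightarrow> 'a vfield \<Rightarrow> 'a \<Rightarrow> real"
  where "app_form \<eta> X = (\<lambda>p. \<eta> p (X p))"

definition app_bilinear :: "'a bilinear_field \<Rightarrow> 'a vfield \<Rightarrow> 'a vfield \<Rightarrow> 'a \<Rightarrow> real"
  where "app_bilinear g X Y = (\<lambda>p. g p (X p) (Y p))"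

definition smooth_endo_field ::
    "('a::topological_space, 'e::euclidean_space) atlas \<Rightarrow> 'a endo_field \<Rightarrow> bool"
  where "smooth_endo_field A \<phi> \<longleftrightarrow>
    (\<forall>p. linear_between (tangent_space A p) (tangent_space A p) (\<phi> p)) \<and>
    (\<forall>X\<in>vector_fields A. app_endo \<phi> X \<in> vector_fields A)"

definition smooth_one_form ::
    "('a::topological_space, 'e::euclidean_space) atlas \<Rightarrow> 'a one_form \<Rightarrow> bool"
  where "smooth_one_form A \<eta> \<longleftrightarrow>
    (\<forall>p. linear_between (tangent_space A p) UNIV (\<eta> p)) \<and>
    (\<forall>X\<in>vector_fields A. app_form \<eta> X \<in> smooth_functions A)"

definition smooth_bilinear_field ::
    "('a::topological_space, 'e::euclidean_space) atlas \<Rightarrow> 'a bilinear_field \<Rightarrow> bool"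
  where "smooth_bilinear_field A g \<longleftrightarrow>
    (\<forall>p. \<forall>v\<in>tangent_space A p.
       linear_between (tangent_space A p) UNIV (\<lambda>w. g p v w) \<and>
       linear_between (tangent_space A p) UNIV (\<lambda>w. g p w v)) \<and>
    (\<forall>X\<in>vector_fields A. \<forall>Y\<in>vector_fields A. app_bilinear g X Y \<in> smooth_functions A)"

definition semi_riemannian_metric ::
    "('a::topological_space, 'e::euclidean_space) atlas \<Rightarrow> 'a bilinear_field \<Rightarrow> bool"
  where "semi_riemannian_metric A g \<longleftrightarrow>
    smooth_bilinear_field A g \<and>
    (\<forall>p. \<forall>v\<in>tangent_space A p. \<forall>w\<in>tangent_space A p. g p v w = g p w v) \<and>
    (\<forall>p. \<forall>v\<in>tangent_space A p. (\<forall>w\<in>tangent_space A p. g p v w = 0) \<longrightarrow> v = 0) \<and>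
    (\<exists>\<nu>. \<forall>p. form_index (tangent_space A p) (g p) = \<nu>)"


section \<open>Connections and curvature\<close>

type_synonym 'a connection = "'a vfield \<Rightarrow> 'a vfield \<Rightarrow> 'a vfield"

definition affine_connection ::
    "('a::topological_space, 'e::euclidean_space) atlas \<Rightarrow> 'a connection \<Rightarrow> bool"
  where "affine_connection A D \<longleftrightarrow>
    (\<forall>X\<in>vector_fields A. \<forall>Y\<in>vector_fields A.
       D X Y \<in> vector_fields A \<and>
       (\<forall>X'\<in>vector_fields A. D (X + X') Y = D X Y + D X' Y) \<and>
       (\<forall>Y'\<in>vector_fields A. D X (Y + Y') = D X Y + D X Y') \<and>
       (\<forall>c. D X (c *\<^sub>R Y) = c *\<^sub>R D X Y) \<and>
       (\<forall>f\<in>smooth_functions A.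
          D (f \<odot> X) Y = f \<odot> D X Y \<and>
          D X (f \<odot> Y) = vderiv X f \<odot> Y + f \<odot> D X Y))"

definition levi_civita_connection ::
    "('a::topological_space, 'e::euclidean_space) atlas \<Rightarrow> 'a bilinear_field \<Rightarrow> 'a connection \<Rightarrow> bool"
  where "levi_civita_connection A g D \<longleftrightarrow>
    affine_connection A D \<and>
    (\<forall>X\<in>vector_fields A. \<forall>Y\<in>vector_fields A. D X Y - D Y X = lie_bracket X Y) \<and>
    (\<forall>X\<in>vector_fields A. \<forall>Y\<in>vector_fields A. \<forall>Z\<in>vector_fields A.
       vderiv X (app_bilinear g Y Z) = app_bilinear g (D X Y) Z + app_bilinear g Y (D X Z))"

definition curvature :: "'a connection \<Rightarrow> 'a vfield \<Rightarrow> 'a vfield \<Rightarrow> 'a vfield \<Rightarrow> 'a vfield"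
  where "curvature D X Y Z = D X (D Y Z) - D Y (D X Z) - D (lie_bracket X Y) Z"

text \<open>The endomorphism of the tangent space at \<open>p\<close> induced by a map \<open>F\<close> of vector fields that is
  linear over the smooth functions: every tangent vector extends to a vector field \<open>X\<close>, and
  \<open>F X p\<close> depends only on \<open>X p\<close>.\<close>

definition at_point ::
    "('a::topological_space, 'e::euclidean_space) atlas \<Rightarrow>
      ('a vfield \<Rightarrow> 'a vfield) \<Rightarrow> 'a \<Rightarrow> 'a tvec \<Rightarrow> 'a tvec"
  where "at_point A F p v = F (SOME X. X \<in> vector_fields A \<and> X p = v) p"

definition ricci ::
    "('a::topological_space, 'e::euclidean_space) atlas \<Rightarrow> 'a connection \<Rightarrow>
      'a vfield \<Rightarrow> 'a vfield \<Rightarrow> 'a \<Rightarrow> real"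
  where "ricci A D Y Z =
    (\<lambda>p. trace_on (tangent_space A p) (at_point A (\<lambda>X. curvature D X Y Z) p))"

definition ricci_semi_symmetric ::
    "('a::topological_space, 'e::euclidean_space) atlas \<Rightarrow> 'a connection \<Rightarrow> bool"
  where "ricci_semi_symmetric A D \<longleftrightarrow>
    (\<forall>X\<in>vector_fields A. \<forall>Y\<in>vector_fields A. \<forall>U\<in>vector_fields A. \<forall>V\<in>vector_fields A.
       ricci A D (curvature D X Y U) V + ricci A D U (curvature D X Y V) = 0)"

definition indefinite_space_form ::
    "('a::topological_space, 'e::euclidean_space) atlas \<Rightarrow> 'a bilinear_field \<Rightarrow> 'a connection \<Rightarrow> bool"
  where "indefinite_space_form A g D \<longleftrightarrow>
    (\<exists>c::real. \<forall>X\<in>vector_fields A. \<forall>Y\<in>vector_fields A. \<forall>Z\<in>vector_fields A.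
       curvature D X Y Z =
         c *\<^sub>R (app_bilinear g Y Z \<odot> X - app_bilinear g X Z \<odot> Y))"


section \<open>Paracontact structures\<close>

locale almost_paracontact_manifold =
  smooth_manifold A
  for A :: "('a::{t2_space,second_countable_topology}, 'e::euclidean_space) atlas" +
  fixes \<phi> :: "'a endo_field"
    and \<xi> :: "'a vfield"
    and \<eta> :: "'a one_form"
  assumes phi_smooth: "smooth_endo_field A \<phi>"
    and xi_smooth: "\<xi> \<in> vector_fields A"
    and eta_smooth: "smooth_one_form A \<eta>"
    and phi_phi: "X \<in> vector_fields A \<Longrightarrow>
      app_endo \<phi> (app_endo \<phi> X) = X - app_form \<eta> X \<odot> \<xi>"
    and eta_xi: "app_form \<eta> \<xi> = (\<lambda>p. 1)"
    and phi_xi: "app_endo \<phi> \<xi> = 0"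
    and eta_phi: "X \<in> vector_fields A \<Longrightarrow> app_form \<eta> (app_endo \<phi> X) = 0"

locale eps_almost_paracontact_metric_manifold =
  almost_paracontact_manifold A \<phi> \<xi> \<eta>
  for A :: "('a::{t2_space,second_countable_topology}, 'e::euclidean_space) atlas"
    and \<phi> \<xi> \<eta> +
  fixes g :: "'a bilinear_field"
    and \<epsilon> :: real
  assumes metric: "semi_riemannian_metric A g"
    and eps: "\<epsilon> \<in> {1, -1}"
    and metric_compatible: "X \<in> vector_fields A \<Longrightarrow> Y \<in> vector_fields A \<Longrightarrow>
      app_bilinear g (app_endo \<phi> X) (app_endo \<phi> Y) =
        app_bilinear g X Y - \<epsilon> *\<^sub>R (app_form \<eta> X * app_form \<eta> Y)"

text \<open>The Levi-Civita connection, which is determined by \<open>g\<close>, is carried along as a parameter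
  \<open>D\<close>. The left-hand side of \<open>para_sasakian\<close> is the covariant derivative of \<open>\<phi>\<close>.\<close>

locale eps_para_sasakian_manifold =
  eps_almost_paracontact_metric_manifold A \<phi> \<xi> \<eta> g \<epsilon>
  for A :: "('a::{t2_space,second_countable_topology}, 'e::euclidean_space) atlas"
    and \<phi> \<xi> \<eta> g \<epsilon> +
  fixes D :: "'a connection"
  assumes levi_civita: "levi_civita_connection A g D"
    and para_sasakian: "X \<in> vector_fields A \<Longrightarrow> Y \<in> vector_fields A \<Longrightarrow>
      D X (app_endo \<phi> Y) - app_endo \<phi> (D X Y) =
        - (app_bilinear g (app_endo \<phi> X) (app_endo \<phi> Y) \<odot> \<xi>)
        - \<epsilon> *\<^sub>R (app_form \<eta> Y \<odot> app_endo \<phi> (app_endo \<phi> X))"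

end

theory Submission
  imports Defs
begin

text \<open>
  The constant curvature is \<open>- \<epsilon>\<close>. The para Sasakian equation forces \<open>D X \<xi> = \<epsilon> \<phi> X\<close> (lemma
  \<open>D_xi\<close>), and differentiating once more gives \<open>R(X, Y)\<xi> = \<eta>(X) Y - \<eta>(Y) X\<close> (lemma \<open>curvature_xi\<close>).
  So the difference \<open>C\<close> between \<open>R\<close> and the tensor of constant curvature \<open>- \<epsilon>\<close> is annihilated by
  \<open>\<xi>\<close> in each of its arguments.

  Inserting \<open>\<xi>\<close> into Ricci-semi-symmetry, \<open>S(R(\<xi>, v)u, \<xi>) + S(u, R(\<xi>, v)\<xi>) = 0\<close>, determines every
  value \<open>S(u, v)\<close> because \<open>S(\<cdot>, \<xi>)\<close> is known: the Ricci tensor is a multiple of the metric, and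
  the trace of \<open>C\<close> vanishes. In dimension three \<open>C\<close> lives on the quotient by \<open>\<xi>\<close>, of dimension at
  most two, where a skew form in two arguments has only one component, and this component can be read off
  from the trace. Hence \<open>C = 0\<close> (lemma \<open>C_eq_0_if_traceless\<close>). This argument takes place in a single
  tangent space, and \<open>- \<epsilon>\<close> is the same at every point.

  Passing from vector fields to a tangent space rests on two facts about tangent vectors, understood
  as derivations of the global smooth functions: each of them is a coordinate vector
  (\<open>tangent_vector_is_coord_vector\<close>), so the tangent space has dimension at most three, and each of
  them extends to a vector field (\<open>vector_field_extension\<close>). Both come from smooth bump functions and on
  the Hadamard lemma. Finally, \<open>R(X, Y)Z\<close> at \<open>p\<close> depends only on the values of the three fields at
  \<open>p\<close> (\<open>curvature_pointwise\<close>): pair symmetry moves any argument into a slot of the metric,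
  where only its value at \<open>p\<close> matters, and the metric is non-degenerate.
\<close>

section \<open>Linear maps between subspaces\<close>

lemma linear_between_add: "linear_between V W f \<Longrightarrow> v \<in> V \<Longrightarrow> w \<in> V \<Longrightarrow> f (v + w) = f v + f w"
  and linear_between_scaleR: "linear_between V W f \<Longrightarrow> v \<in> V \<Longrightarrow> f (c *\<^sub>R v) = c *\<^sub>R f v"
  and linear_between_mem: "linear_between V W f \<Longrightarrow> v \<in> V \<Longrightarrow> f v \<in> W"
  by (auto simp: linear_between_def)

lemma linear_between_zero: "linear_between V W f \<Longrightarrow> 0 \<in> V \<Longrightarrow> f 0 = 0"
  using linear_between_scaleR[of V W f 0 0] by simp

lemma linear_between_diff:
  "linear_between V W f \<Longrightarrow> subspace V \<Longrightarrow> v \<in> V \<Longrightarrow> w \<in> V \<Longrightarrow> f (v - w) = f v - f w"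
  using linear_between_add[of V W f v "- 1 *\<^sub>R w"] linear_between_scaleR[of V W f w "- 1"]
    subspace_scale[of V w "- 1"]
  by simp

lemma linear_between_sum:
  assumes "linear_between V W f" "subspace V" "\<And>i. i \<in> I \<Longrightarrow> v i \<in> V"
  shows "f (\<Sum>i\<in>I. c i *\<^sub>R v i) = (\<Sum>i\<in>I. c i *\<^sub>R f (v i))"
  using assms(3)
proof (induction I rule: infinite_finite_induct)
  case (insert i I)
  then show ?case
    using linear_between_add[OF assms(1), of "c i *\<^sub>R v i" "\<Sum>i\<in>I. c i *\<^sub>R v i"]
      linear_between_scaleR[OF assms(1), of "v i" "c i"] assms(2)
    by (auto intro: subspace_scale subspace_sum)
qed (use assms in \<open>auto intro: linear_between_zero subspace_0\<close>)

section \<open>Calculus of smooth functions on Euclidean space\<close>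

lemma Ck_on_subset: "Ck_on k S f \<Longrightarrow> T \<subseteq> S \<Longrightarrow> Ck_on k T f"
  by (induction k arbitrary: f) (auto intro: continuous_on_subset)

lemma Ck_on_SucD: "Ck_on (Suc k) S f \<Longrightarrow> Ck_on k S f"
proof (induction k arbitrary: f)
  case 0
  then show ?case
    by (auto intro!: continuous_at_imp_continuous_on differentiable_imp_continuous_within)
next
  case (Suc k)
  then show ?case by (metis Ck_on.simps(2))
qed

lemma Ck_on_cong:
  assumes "open S" "\<And>x. x \<in> S \<Longrightarrow> f x = h x" "Ck_on k S f"
  shows "Ck_on k S h"
  using assms(2,3)
proof (induction k arbitrary: f h)
  case 0
  then show ?case by (metis Ck_on.simps(1) continuous_on_cong)
next
  case (Suc k)
  have der: "(h has_derivative frechet_derivative f (at x)) (at x)" if "x \<in> S" for x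
  proof (rule has_derivative_transform_within_open[OF _ assms(1) that Suc.prems(1)])
    show "(f has_derivative frechet_derivative f (at x)) (at x)"
      using Suc.prems(2) that by (simp add: frechet_derivative_works[symmetric])
  qed
  have "Ck_on k S (\<lambda>x. frechet_derivative h (at x) v)" for v
  proof (rule Suc.IH)
    show "Ck_on k S (\<lambda>x. frechet_derivative f (at x) v)" using Suc.prems(2) by simp
    show "frechet_derivative f (at x) v = frechet_derivative h (at x) v" if "x \<in> S" for x
      using frechet_derivative_at[OF der[OF that]] by (rule fun_cong)
  qed
  then show ?case using der by (auto simp: differentiable_def)
qed

text \<open>Any expression \<open>f'\<close> for the derivative may stand in for \<open>frechet_derivative f\<close>, so the
  inductions below can use the usual differentiation rules.\<close>

lemma Ck_on_Suc_derivI: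
  assumes "open S" and der: "\<And>x. x \<in> S \<Longrightarrow> (f has_derivative f' x) (at x)"
    and "\<And>v. Ck_on k S (\<lambda>x. f' x v)"
  shows "Ck_on (Suc k) S f"
proof -
  have "Ck_on k S (\<lambda>x. frechet_derivative f (at x) v)" for v
    by (rule Ck_on_cong[OF assms(1) _ assms(3)[of v]]) (simp add: frechet_derivative_at[OF der, symmetric])
  then show ?thesis
    using der by (auto simp: differentiable_def)
qed

lemma Ck_on_has_derivative:
  "Ck_on (Suc k) S f \<Longrightarrow> x \<in> S \<Longrightarrow> (f has_derivative frechet_derivative f (at x)) (at x)"
  by (simp add: frechet_derivative_works[symmetric])

text \<open>Differentiability is a local matter, so a function may be checked on the members of an open cover;
  this is how functions are extended by zero.\<close>

lemma Ck_on_Un: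
  assumes "open S" "open T"
  shows "Ck_on k S f \<Longrightarrow> Ck_on k T f \<Longrightarrow> Ck_on k (S \<union> T) f"
  using assms by (induction k arbitrary: f) (auto intro: continuous_on_open_Un)

lemma Ck_on_const: "Ck_on k S (\<lambda>x. c)"
  by (induction k arbitrary: c) (auto simp: frechet_derivative_const)

lemma Ck_on_bounded_linear_compose:
  assumes "bounded_linear L" "open S"
  shows "Ck_on k S f \<Longrightarrow> Ck_on k S (\<lambda>x. L (f x))"
proof (induction k arbitrary: f)
  case 0
  then show ?case using assms by (auto intro: bounded_linear.continuous_on)
next
  case (Suc k)
  show ?case
    using Suc Ck_on_has_derivative[OF Suc.prems]
    by (intro Ck_on_Suc_derivI[OF assms(2) bounded_linear.has_derivative[OF assms(1)]]) auto
qed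

lemma Ck_on_add:
  assumes "open S"
  shows "Ck_on k S f \<Longrightarrow> Ck_on k S h \<Longrightarrow> Ck_on k S (\<lambda>x. f x + h x)"
proof (induction k arbitrary: f h)
  case 0
  then show ?case by (auto intro: continuous_on_add)
next
  case (Suc k)
  show ?case
    using Suc Ck_on_has_derivative[OF Suc.prems(1)] Ck_on_has_derivative[OF Suc.prems(2)]
    by (intro Ck_on_Suc_derivI[OF assms has_derivative_add]) auto
qed

lemma Ck_on_sum:
  assumes "open S" "\<And>i. i \<in> I \<Longrightarrow> Ck_on k S (f i)"
  shows "Ck_on k S (\<lambda>x. \<Sum>i\<in>I. f i x)"
  using assms(2)
  by (induction I rule: infinite_finite_induct) (auto intro: Ck_on_const Ck_on_add[OF assms(1)])

lemma Ck_on_scaleR: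
  assumes "open S"
  shows "Ck_on k S r \<Longrightarrow> Ck_on k S f \<Longrightarrow> Ck_on k S (\<lambda>x. r x *\<^sub>R f x)"
proof (induction k arbitrary: r f)
  case 0
  then show ?case by (auto intro: continuous_on_scaleR)
next
  case (Suc k)
  show ?case
    using Suc Ck_on_has_derivative[OF Suc.prems(1)] Ck_on_has_derivative[OF Suc.prems(2)]
      Suc.prems[THEN Ck_on_SucD]
    by (intro Ck_on_Suc_derivI[OF assms has_derivative_scaleR]) (auto intro!: Ck_on_add assms)
qed

lemma Ck_on_id: "open S \<Longrightarrow> Ck_on k S (\<lambda>x. x)"
proof (cases k)
  case (Suc n)
  assume "open S"
  then show ?thesis
    unfolding Suc by (rule Ck_on_Suc_derivI) (auto intro: Ck_on_const has_derivative_ident)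
qed auto

lemma linear_Basis_expansion:
  fixes L :: "'b::euclidean_space \<Rightarrow> 'c::real_vector"
  assumes "linear L"
  shows "L v = (\<Sum>b\<in>Basis. (v \<bullet> b) *\<^sub>R L b)"
proof -
  have "L v = L (\<Sum>b\<in>Basis. (v \<bullet> b) *\<^sub>R b)" by (simp only: euclidean_representation)
  then show ?thesis by (simp only: linear_sum[OF assms] linear_scale[OF assms])
qed

text \<open>Expanding the inner derivative in a basis writes the derivative of \<open>f \<circ> u\<close> as a finite sum of products
  of a partial derivative of \<open>f\<close>, composed with \<open>u\<close>, and a component of the derivative of \<open>u\<close>.
  Both factors are covered by the induction hypothesis or are one order smoother.\<close>

lemma Ck_on_compose:
  fixes u :: "'x::real_normed_vector \<Rightarrow> 'b::euclidean_space"
    and f :: "'b \<Rightarrow> 'c::real_normed_vector"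
  assumes "open S" "open T" and "u ` S \<subseteq> T"
  shows "Ck_on k T f \<Longrightarrow> Ck_on k S u \<Longrightarrow> Ck_on k S (\<lambda>x. f (u x))"
  using assms(3)
proof (induction k arbitrary: f u)
  case 0
  then show ?case by (auto intro: continuous_on_compose2)
next
  case (Suc k)
  let ?f' = "\<lambda>y. frechet_derivative f (at y)" and ?u' = "\<lambda>x. frechet_derivative u (at x)"
  have expand: "?f' (u x) (?u' x v) = (\<Sum>b\<in>Basis. (?u' x v \<bullet> b) *\<^sub>R ?f' (u x) b)"
    if "x \<in> S" for x v
  proof -
    have "linear (?f' (u x))"
      using Suc.prems(1,3) that by (intro linear_frechet_derivative) auto
    then show ?thesis by (rule linear_Basis_expansion)
  qed
  have "Ck_on k S (\<lambda>x. \<Sum>b\<in>Basis. (?u' x v \<bullet> b) *\<^sub>R ?f' (u x) b)" for v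
  proof (intro Ck_on_sum Ck_on_scaleR assms(1))
    fix b :: 'b
    show "Ck_on k S (\<lambda>x. ?u' x v \<bullet> b)"
      using Suc.prems(2)
      by (intro Ck_on_bounded_linear_compose[OF bounded_linear_inner_left assms(1)]) auto
    show "Ck_on k S (\<lambda>x. ?f' (u x) b)"
      using Suc.prems Ck_on_SucD[OF Suc.prems(2)]
      by (intro Suc.IH[where f = "\<lambda>y. ?f' y b"]) auto
  qed
  then have "Ck_on k S (\<lambda>x. ?f' (u x) (?u' x v))" for v
    by (rule Ck_on_cong[OF assms(1), rotated]) (simp add: expand)
  moreover have "((\<lambda>x. f (u x)) has_derivative (\<lambda>v. ?f' (u x) (?u' x v))) (at x)"
    if "x \<in> S" for x
    using Suc.prems that
    by (intro has_derivative_compose[OF Ck_on_has_derivative Ck_on_has_derivative]) auto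
  ultimately show ?case
    by (intro Ck_on_Suc_derivI[OF assms(1)])
qed

lemma smooth_on_subset: "smooth_on S f \<Longrightarrow> T \<subseteq> S \<Longrightarrow> smooth_on T f"
  by (auto simp: smooth_on_def intro: Ck_on_subset)

lemma smooth_on_cong: "open S \<Longrightarrow> (\<And>x. x \<in> S \<Longrightarrow> f x = h x) \<Longrightarrow> smooth_on S f \<Longrightarrow> smooth_on S h"
  unfolding smooth_on_def using Ck_on_cong by blast

lemma smooth_on_Un: "open S \<Longrightarrow> open T \<Longrightarrow> smooth_on S f \<Longrightarrow> smooth_on T f \<Longrightarrow> smooth_on (S \<union> T) f"
  by (auto simp: smooth_on_def intro: Ck_on_Un)

lemma smooth_on_const: "smooth_on S (\<lambda>x. c)"
  by (auto simp: smooth_on_def intro: Ck_on_const)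

lemma smooth_on_id: "open S \<Longrightarrow> smooth_on S (\<lambda>x. x)"
  by (auto simp: smooth_on_def intro: Ck_on_id)

lemma smooth_on_bounded_linear:
  "bounded_linear L \<Longrightarrow> open S \<Longrightarrow> smooth_on S f \<Longrightarrow> smooth_on S (\<lambda>x. L (f x))"
  by (auto simp: smooth_on_def intro: Ck_on_bounded_linear_compose)

lemma smooth_on_add:
  "open S \<Longrightarrow> smooth_on S f \<Longrightarrow> smooth_on S h \<Longrightarrow> smooth_on S (\<lambda>x. f x + h x)"
  by (auto simp: smooth_on_def intro: Ck_on_add)

lemma smooth_on_sum:
  "open S \<Longrightarrow> (\<And>i. i \<in> I \<Longrightarrow> smooth_on S (f i)) \<Longrightarrow> smooth_on S (\<lambda>x. \<Sum>i\<in>I. f i x)"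
  by (auto simp: smooth_on_def intro: Ck_on_sum)

lemma smooth_on_mult:
  fixes f h :: "'x::real_normed_vector \<Rightarrow> real"
  shows "open S \<Longrightarrow> smooth_on S f \<Longrightarrow> smooth_on S h \<Longrightarrow> smooth_on S (\<lambda>x. f x * h x)"
  using Ck_on_scaleR[of S _ f h] by (auto simp: smooth_on_def)

lemma smooth_on_diff:
  assumes "open S" "smooth_on S f" "smooth_on S h"
  shows "smooth_on S (\<lambda>x. f x - h x)"
  using smooth_on_add[OF assms(1,2)
      smooth_on_bounded_linear[OF bounded_linear_minus[OF bounded_linear_ident] assms(1,3)]]
  by simp

lemma smooth_on_compose:
  fixes u :: "'x::real_normed_vector \<Rightarrow> 'b::euclidean_space"
  shows "open S \<Longrightarrow> open T \<Longrightarrow> u ` S \<subseteq> T \<Longrightarrow> smooth_on T f \<Longrightarrow> smooth_on S u \<Longrightarrow>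
    smooth_on S (\<lambda>x. f (u x))"
  by (auto simp: smooth_on_def intro: Ck_on_compose)

lemma smooth_on_has_derivative:
  "smooth_on S f \<Longrightarrow> x \<in> S \<Longrightarrow> (f has_derivative frechet_derivative f (at x)) (at x)"
  unfolding smooth_on_def by (meson Ck_on_has_derivative)

lemma smooth_on_frechet_derivative:
  "smooth_on S f \<Longrightarrow> smooth_on S (\<lambda>x. frechet_derivative f (at x) v)"
  unfolding smooth_on_def using Ck_on.simps(2) by blast

text \<open>The powers of \<open>x\<close> in the denominator make the family closed under differentiation, so that
  smoothness of all members follows by one induction.\<close>

definition flat_exp :: "nat \<Rightarrow> real \<Rightarrow> real"
  where "flat_exp n x = (if x > 0 then exp (- 1 / x) / x ^ n else 0)"

lemma flat_exp_tendsto_0: "(flat_exp n \<longlongrightarrow> 0) (at 0)"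
proof -
  have "((\<lambda>x::real. inverse x ^ n / exp (inverse x)) \<longlongrightarrow> 0) (at_right 0)"
    using filterlim_compose[OF tendsto_power_div_exp_0 filterlim_inverse_at_top_right] .
  moreover have "\<forall>\<^sub>F x in at_right 0. inverse x ^ n / exp (inverse x) = flat_exp n x"
    by (auto simp: eventually_at_filter flat_exp_def exp_minus divide_simps)
  ultimately have "(flat_exp n \<longlongrightarrow> 0) (at_right 0)"
    by (rule Lim_transform_eventually)
  moreover have "(flat_exp n \<longlongrightarrow> 0) (at_left 0)"
    by (rule Lim_transform_eventually[OF tendsto_const])
      (auto simp: eventually_at_filter flat_exp_def)
  ultimately show ?thesis
    by (simp add: filterlim_split_at)
qed

text \<open>At the origin the difference quotient of one member of the family is the next member, which
  tends to zero there.\<close>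

lemma flat_exp_has_real_derivative:
  "(flat_exp n has_real_derivative (flat_exp (n + 2) x - n * flat_exp (n + 1) x)) (at x)"
proof (cases x "0::real" rule: linorder_cases)
  case less
  have "(flat_exp n has_real_derivative 0) (at x)"
    by (rule has_field_derivative_transform_within_open[OF DERIV_const[of 0] open_lessThan[of 0]])
      (use less in \<open>auto simp: flat_exp_def\<close>)
  then show ?thesis using less by (simp add: flat_exp_def)
next
  case equal
  have "((\<lambda>h. (flat_exp n (0 + h) - flat_exp n 0) / h) \<longlongrightarrow> 0) (at 0)"
    by (rule Lim_transform_eventually[OF flat_exp_tendsto_0[of "n + 1"]])
      (auto simp: eventually_at_filter flat_exp_def)
  then show ?thesis using equal by (simp add: DERIV_def flat_exp_def)
next
  case greater
  let ?E = "exp (- 1 / x)"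
  have "((\<lambda>x. exp (- 1 / x) / x ^ n) has_real_derivative
      (?E * (1 / x\<^sup>2) * x ^ n - ?E * (n * x ^ (n - 1))) / (x ^ n * x ^ n)) (at x)"
    using greater by (auto intro!: derivative_eq_intros simp: power2_eq_square)
  moreover have "(?E * (1 / x\<^sup>2) * x ^ n - ?E * (n * x ^ (n - 1))) / (x ^ n * x ^ n) =
      flat_exp (n + 2) x - n * flat_exp (n + 1) x"
    using greater by (cases n) (simp_all add: flat_exp_def field_simps power2_eq_square)
  ultimately have "((\<lambda>x. exp (- 1 / x) / x ^ n) has_real_derivative
      (flat_exp (n + 2) x - n * flat_exp (n + 1) x)) (at x)"
    by simp
  then show ?thesis
    by (rule has_field_derivative_transform_within_open[OF _ open_greaterThan[of 0]])
      (use greater in \<open>auto simp: flat_exp_def\<close>)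
qed

lemma Ck_on_flat_exp: "Ck_on k UNIV (flat_exp n)"
proof (induction k arbitrary: n)
  case 0
  have "isCont (flat_exp n) x" for x
    using flat_exp_has_real_derivative by (rule DERIV_isCont)
  then show ?case by (simp add: continuous_at_imp_continuous_on)
next
  case (Suc k)
  have "Ck_on k UNIV (\<lambda>x. v *\<^sub>R (flat_exp (n + 2) x + (- real n) *\<^sub>R flat_exp (n + 1) x))" for v
    by (intro Ck_on_scaleR Ck_on_add Ck_on_const open_UNIV Suc.IH)
  then have "Ck_on k UNIV (\<lambda>x. (flat_exp (n + 2) x - n * flat_exp (n + 1) x) * v)" for v
    by (simp add: mult.commute)
  then show ?case
    using flat_exp_has_real_derivative[of n, unfolded has_field_derivative_def]
    by (intro Ck_on_Suc_derivI[OF open_UNIV])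
qed

text \<open>Only the value at the centre enters below, as a positive factor that is divided out.\<close>

definition bump :: "'b::euclidean_space \<Rightarrow> real \<Rightarrow> 'b \<Rightarrow> real"
  where "bump p r x = flat_exp 0 (r\<^sup>2 - (x - p) \<bullet> (x - p))"

lemma smooth_on_bump: "smooth_on UNIV (bump p r)"
proof -
  have "smooth_on UNIV (\<lambda>x. r\<^sup>2 - (\<Sum>b\<in>Basis. ((x - p) \<bullet> b) * ((x - p) \<bullet> b)))"
    by (intro smooth_on_diff smooth_on_const smooth_on_sum smooth_on_mult open_UNIV
        smooth_on_bounded_linear[OF bounded_linear_inner_left] smooth_on_id)
  then have "smooth_on UNIV (\<lambda>x. r\<^sup>2 - (x - p) \<bullet> (x - p))"
    by (subst euclidean_inner)
  then show ?thesis
    unfolding bump_def[abs_def]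
    by (rule smooth_on_compose[OF open_UNIV open_UNIV subset_UNIV, rotated])
      (auto simp: smooth_on_def Ck_on_flat_exp)
qed

lemma bump_center: "r > 0 \<Longrightarrow> bump p r p > 0"
  by (simp add: bump_def flat_exp_def)

lemma bump_outside:
  assumes "x \<notin> cball p r" "r > 0" shows "bump p r x = 0"
proof -
  have "r\<^sup>2 \<le> (norm (x - p))\<^sup>2"
    using assms by (intro power_mono) (auto simp: dist_norm norm_minus_commute)
  then show ?thesis by (simp add: bump_def flat_exp_def dot_square_norm)
qed

lemma segment_in_ball:
  fixes x p :: "'b::real_normed_vector"
  assumes "x \<in> ball p R" "t \<in> {0..1}"
  shows "p + t *\<^sub>R (x - p) \<in> ball p R"
proof -
  have "dist p (p + t *\<^sub>R (x - p)) = \<bar>t\<bar> * norm (x - p)"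
    by (simp add: dist_norm)
  then have "dist p (p + t *\<^sub>R (x - p)) = t * dist p x"
    using assms by (simp add: dist_norm norm_minus_commute)
  also have "\<dots> \<le> dist p x" using assms by (auto intro: mult_left_le_one_le)
  finally show ?thesis using assms by simp
qed

text \<open>The weight \<open>t ^ n\<close> makes the induction work: differentiating under the integral sign replaces \<open>f\<close> by
  a directional derivative and, by the chain rule, raises the power of \<open>t\<close> by one.\<close>

lemma Ck_on_segment_integral:
  fixes f :: "'b::euclidean_space \<Rightarrow> real"
  shows "Ck_on k (ball p R) f \<Longrightarrow>
    Ck_on k (ball p R) (\<lambda>x. integral {0..1} (\<lambda>t. t ^ n * f (p + t *\<^sub>R (x - p))))"
proof (induction k arbitrary: f n)
  case 0
  have "continuous_on (ball p R) (\<lambda>x. integral (cbox 0 1) (\<lambda>t. t ^ n * f (p + t *\<^sub>R (x - p))))"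
    using 0 segment_in_ball[of _ p R]
    by (intro integral_continuous_on_param)
      (auto simp: case_prod_beta intro!: continuous_intros continuous_on_compose2[of "ball p R" f])
  then show ?case by simp
next
  case (Suc k)
  let ?B = "ball p R" and ?f' = "\<lambda>y. frechet_derivative f (at y)"
  let ?seg = "\<lambda>x t. p + t *\<^sub>R (x - p)"
  define G where "G x t = (t ^ Suc n) *\<^sub>R Blinfun (?f' (?seg x t))" for x t
  have contf: "continuous_on ?B f"
    using Suc.prems Ck_on_SucD[OF Suc.prems]
    by (auto intro!: continuous_at_imp_continuous_on differentiable_imp_continuous_within)
  have contf': "continuous_on ?B (\<lambda>y. ?f' y v)" for v
  proof -
    \<comment> \<open>Continuity is the lowest order of smoothness and is reached by descending from order \<open>k\<close>.\<close>
    have "Ck_on k ?B (\<lambda>y. ?f' y v)" using Suc.prems by simp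
    then have "Ck_on 0 ?B (\<lambda>y. ?f' y v)" by (induction k) (auto intro: Ck_on_SucD simp del: Ck_on.simps)
    then show ?thesis by simp
  qed
  have bl: "bounded_linear (?f' y)" if "y \<in> ?B" for y
    using Ck_on_has_derivative[OF Suc.prems that] by (rule has_derivative_bounded_linear)
  have G_apply: "G x t v = t ^ Suc n * ?f' (?seg x t) v" if "x \<in> ?B" "t \<in> {0..1}" for x t v
    unfolding G_def by (simp add: bounded_linear_Blinfun_apply[OF bl[OF segment_in_ball[OF that]]] scaleR_blinfun.rep_eq)
  have der: "((\<lambda>x. t ^ n * f (?seg x t)) has_derivative blinfun_apply (G x t)) (at x within ?B)"
    if "x \<in> ?B" "t \<in> {0..1}" for x t
  proof -
    have seg: "((\<lambda>x. ?seg x t) has_derivative (\<lambda>v. t *\<^sub>R v)) (at x within ?B)"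
      by (auto intro!: derivative_eq_intros)
    have "((\<lambda>x. f (?seg x t)) has_derivative (\<lambda>v. ?f' (?seg x t) (t *\<^sub>R v))) (at x within ?B)"
      using has_derivative_compose[OF seg Ck_on_has_derivative[OF Suc.prems segment_in_ball[OF that]]] .
    then have "((\<lambda>x. t ^ n * f (?seg x t)) has_derivative (\<lambda>v. t ^ n * ?f' (?seg x t) (t *\<^sub>R v)))
        (at x within ?B)"
      by (rule has_derivative_mult_right)
    moreover have "blinfun_apply (G x t) = (\<lambda>v. t ^ n * ?f' (?seg x t) (t *\<^sub>R v))"
      using G_apply[OF that] linear_scale[OF bounded_linear.linear[OF bl[OF segment_in_ball[OF that]]]]
      by (auto simp: fun_eq_iff)
    ultimately show ?thesis by simp
  qed
  have cont_G: "continuous_on (?B \<times> cbox 0 1) (\<lambda>(x, t). G x t)"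
  proof (rule continuous_on_blinfun_componentwise)
    fix b :: 'b
    have "continuous_on (?B \<times> cbox 0 1) (\<lambda>z. snd z ^ Suc n * ?f' (?seg (fst z) (snd z)) b)"
      using segment_in_ball[of _ p R]
      by (intro continuous_intros continuous_on_compose2[OF contf']) auto
    moreover have "snd z ^ Suc n * ?f' (?seg (fst z) (snd z)) b =
        blinfun_apply (case z of (x, t) \<Rightarrow> G x t) b" if "z \<in> ?B \<times> cbox 0 1" for z
      using that by (cases z) (auto simp: G_apply)
    ultimately show "continuous_on (?B \<times> cbox 0 1) (\<lambda>z. blinfun_apply (case z of (x, t) \<Rightarrow> G x t) b)"
      by (rule continuous_on_eq)
  qed
  have cont_Gx: "continuous_on {0..1} (G x)" if "x \<in> ?B" for x
    using that by (intro continuous_on_compose2[OF cont_G, of _ "\<lambda>t. (x, t)", simplified] continuous_intros) auto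
  have der_within: "((\<lambda>x. integral (cbox 0 1) (\<lambda>t. t ^ n * f (?seg x t))) has_derivative
      blinfun_apply (integral (cbox 0 1) (G x))) (at x within ?B)" if "x \<in> ?B" for x
  proof (rule leibniz_rule)
    fix x assume "x \<in> ?B"
    then show "(\<lambda>t. t ^ n * f (?seg x t)) integrable_on cbox 0 1"
      using segment_in_ball[of x p R]
      by (intro integrable_continuous continuous_intros continuous_on_compose2[OF contf]) auto
  qed (use der cont_G that in auto)
  have der_int: "((\<lambda>x. integral {0..1} (\<lambda>t. t ^ n * f (?seg x t))) has_derivative
      blinfun_apply (integral {0..1} (G x))) (at x)" if "x \<in> ?B" for x
    using der_within[OF that] unfolding at_within_open[OF that open_ball] box_real .
  have "Ck_on k ?B (\<lambda>x. blinfun_apply (integral {0..1} (G x)) v)" for v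
  proof (rule Ck_on_cong[OF open_ball])
    show "Ck_on k ?B (\<lambda>x. integral {0..1} (\<lambda>t. t ^ Suc n * ?f' (?seg x t) v))"
      using Suc.prems by (intro Suc.IH) auto
    fix x assume x: "x \<in> ?B"
    have "blinfun_apply (integral {0..1} (G x)) v = integral {0..1} (\<lambda>t. G x t v)"
      using integrable_continuous_real[OF cont_Gx[OF x]] by (rule blinfun_apply_integral)
    also have "\<dots> = integral {0..1} (\<lambda>t. t ^ Suc n * ?f' (?seg x t) v)"
      using G_apply[OF x] by (intro integral_cong) auto
    finally show "integral {0..1} (\<lambda>t. t ^ Suc n * ?f' (?seg x t) v) =
      blinfun_apply (integral {0..1} (G x)) v" by simp
  qed
  then show ?case
    using der_int by (intro Ck_on_Suc_derivI[OF open_ball])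
qed

text \<open>Integrate the derivative of \<open>f\<close> along the segment from \<open>p\<close> to \<open>x\<close> and expand \<open>x - p\<close> in a
  basis; the coefficients are the integrals of the partial derivatives.\<close>

lemma hadamard:
  fixes f :: "'b::euclidean_space \<Rightarrow> real"
  assumes f: "smooth_on (ball p R) f" and "R > 0"
  obtains h where "\<And>b. smooth_on (ball p R) (h b)"
    and "\<And>b. h b p = frechet_derivative f (at p) b"
    and "\<And>x. x \<in> ball p R \<Longrightarrow> f x = f p + (\<Sum>b\<in>Basis. ((x - p) \<bullet> b) * h b x)"
proof
  let ?B = "ball p R" and ?f' = "\<lambda>y. frechet_derivative f (at y)"
  let ?seg = "\<lambda>x t. p + t *\<^sub>R (x - p)"
  define h where "h b x = integral {0..1} (\<lambda>t. ?f' (?seg x t) b)" for b x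
  show "smooth_on ?B (h b)" for b
    using Ck_on_segment_integral[of _ p R "\<lambda>y. ?f' y b" 0] smooth_on_frechet_derivative[OF f]
    by (simp add: smooth_on_def h_def[abs_def])
  show "h b p = ?f' p b" for b
    by (simp add: h_def)
  fix x assume x: "x \<in> ?B"
  note seg = segment_in_ball[OF x]
  have cont: "continuous_on {0..1} (\<lambda>t. ?f' (?seg x t) b)" for b
  proof -
    have "Ck_on 0 ?B (\<lambda>y. ?f' y b)"
      using smooth_on_frechet_derivative[OF f] by (simp add: smooth_on_def)
    then show ?thesis
      by (intro continuous_on_compose2[of ?B "\<lambda>y. ?f' y b" _ "?seg x"])
        (use seg in \<open>auto intro!: continuous_intros\<close>)
  qed
  have expand: "?f' (?seg x t) (x - p) = (\<Sum>b\<in>Basis. ((x - p) \<bullet> b) * ?f' (?seg x t) b)"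
    if "t \<in> {0..1}" for t
    using linear_Basis_expansion[of "?f' (?seg x t)" "x - p"]
      smooth_on_has_derivative[OF f seg[OF that], THEN has_derivative_linear] by simp
  have "((\<lambda>t. f (?seg x t)) has_vector_derivative ?f' (?seg x t) (x - p)) (at t within {0..1})"
    if "t \<in> {0..1}" for t
  proof -
    have "((\<lambda>t. ?seg x t) has_derivative (\<lambda>s. s *\<^sub>R (x - p))) (at t within {0..1})"
      by (auto intro!: derivative_eq_intros)
    from has_derivative_compose[OF this smooth_on_has_derivative[OF f seg[OF that]]]
    have "((\<lambda>t. f (?seg x t)) has_derivative (\<lambda>s. ?f' (?seg x t) (s *\<^sub>R (x - p)))) (at t within {0..1})" .
    moreover have "?f' (?seg x t) (s *\<^sub>R (x - p)) = s *\<^sub>R ?f' (?seg x t) (x - p)" for s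
      by (rule linear_scale[OF has_derivative_linear[OF smooth_on_has_derivative[OF f seg[OF that]]]])
    ultimately show ?thesis
      unfolding has_vector_derivative_def by (simp only:)
  qed
  then have "((\<lambda>t. ?f' (?seg x t) (x - p)) has_integral f (?seg x 1) - f (?seg x 0)) {0..1}"
    by (intro fundamental_theorem_of_calculus) auto
  then have "f x - f p = integral {0..1} (\<lambda>t. ?f' (?seg x t) (x - p))"
    by (simp add: integral_unique)
  also have "\<dots> = integral {0..1} (\<lambda>t. \<Sum>b\<in>Basis. ((x - p) \<bullet> b) * ?f' (?seg x t) b)"
    using expand by (intro integral_cong) auto
  also have "\<dots> = (\<Sum>b\<in>Basis. ((x - p) \<bullet> b) * h b x)"
    using cont by (subst integral_sum) (auto simp: h_def intro!: integrable_continuous_real continuous_intros)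
  finally show "f x = f p + (\<Sum>b\<in>Basis. ((x - p) \<bullet> b) * h b x)" by simp
qed

section \<open>Tangent vectors and vector fields\<close>

lemma sum_fun_apply: "(\<Sum>i\<in>I. f i) x = (\<Sum>i\<in>I. f i x)"
  by (induction I rule: infinite_finite_induct) auto

context smooth_manifold
begin

lemma chart_open: "(U, \<psi>) \<in> A \<Longrightarrow> open U"
  and chart_image_open: "(U, \<psi>) \<in> A \<Longrightarrow> open (\<psi> ` U)"
  using chart by blast+

lemma chart_inv: "(U, \<psi>) \<in> A \<Longrightarrow> q \<in> U \<Longrightarrow> inv_into U \<psi> (\<psi> q) = q"
  using chart unfolding homeomorphism_def by blast

lemma chart_continuous_inv: "(U, \<psi>) \<in> A \<Longrightarrow> continuous_on (\<psi> ` U) (inv_into U \<psi>)"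
  using chart unfolding homeomorphism_def by blast

lemma chart_inv_mem: "x \<in> \<psi> ` U \<Longrightarrow> inv_into U \<psi> x \<in> U"
  by (rule inv_into_into)

lemma chart_inv_right: "x \<in> \<psi> ` U \<Longrightarrow> \<psi> (inv_into U \<psi> x) = x"
  by (rule f_inv_into_f)

lemma chart_open_map:
  assumes "(U, \<psi>) \<in> A" "open T" "T \<subseteq> U"
  shows "open (\<psi> ` T)"
proof -
  have "\<psi> ` T = inv_into U \<psi> -` T \<inter> \<psi> ` U"
  proof (intro subset_antisym subsetI)
    fix x assume "x \<in> \<psi> ` T"
    then show "x \<in> inv_into U \<psi> -` T \<inter> \<psi> ` U"
      using assms(3) chart_inv[OF assms(1)] by auto
  next
    fix x assume x: "x \<in> inv_into U \<psi> -` T \<inter> \<psi> ` U"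
    then have "\<psi> (inv_into U \<psi> x) \<in> \<psi> ` T" by (intro imageI) simp
    moreover have "\<psi> (inv_into U \<psi> x) = x" using x by (intro chart_inv_right) simp
    ultimately show "x \<in> \<psi> ` T" by (simp only:)
  qed
  then show ?thesis
    using continuous_open_preimage[OF chart_continuous_inv[OF assms(1)] chart_image_open[OF assms(1)] assms(2)]
    by (simp only: Int_commute)
qed

lemma chart_around:
  obtains U \<psi> where "(U, \<psi>) \<in> A" "p \<in> U"
proof -
  have "p \<in> (\<Union>(U, \<psi>)\<in>A. U)" unfolding cover by (rule UNIV_I)
  then show ?thesis using that by auto
qed

lemma smooth_functionsD:
  "f \<in> smooth_functions A \<Longrightarrow> (U, \<psi>) \<in> A \<Longrightarrow> smooth_on (\<psi> ` U) (f \<circ> inv_into U \<psi>)"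
  unfolding smooth_functions_def by blast

lemma smooth_functionsI:
  "(\<And>U \<psi>. (U, \<psi>) \<in> A \<Longrightarrow> smooth_on (\<psi> ` U) (f \<circ> inv_into U \<psi>)) \<Longrightarrow> f \<in> smooth_functions A"
  unfolding smooth_functions_def by blast

lemma smooth_functions_const: "(\<lambda>p. c) \<in> smooth_functions A"
  by (intro smooth_functionsI) (simp add: comp_def smooth_on_const)

lemma smooth_functions_add:
  "f \<in> smooth_functions A \<Longrightarrow> h \<in> smooth_functions A \<Longrightarrow> f + h \<in> smooth_functions A"
  using smooth_on_add[OF chart_image_open smooth_functionsD smooth_functionsD]
  by (intro smooth_functionsI) (simp add: comp_def)

lemma smooth_functions_mult:
  "f \<in> smooth_functions A \<Longrightarrow> h \<in> smooth_functions A \<Longrightarrow> f * h \<in> smooth_functions A"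
  using smooth_on_mult[OF chart_image_open smooth_functionsD smooth_functionsD]
  by (intro smooth_functionsI) (simp add: comp_def)

lemma smooth_functions_scaleR:
  "f \<in> smooth_functions A \<Longrightarrow> c *\<^sub>R f \<in> smooth_functions A"
  using smooth_functions_mult[OF smooth_functions_const[of c]]
  by (simp add: times_fun_def scaleR_fun_def)

lemma smooth_functions_subspace: "subspace (smooth_functions A)"
  using smooth_functions_const[of 0]
  by (auto simp: subspace_def smooth_functions_add smooth_functions_scaleR zero_fun_def)

lemmas smooth_functions_diff = subspace_diff[OF smooth_functions_subspace]

definition chart_extension :: "'a set \<Rightarrow> ('a \<Rightarrow> 'e) \<Rightarrow> ('e \<Rightarrow> real) \<Rightarrow> 'a \<Rightarrow> real"
  where "chart_extension U \<psi> F q = (if q \<in> U then F (\<psi> q) else 0)"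

text \<open>On the overlap with another chart the extension is \<open>F\<close> after a smooth change of coordinates. Away
  from the image of \<open>K\<close> it is zero, and that region is open because a compact subset of a Hausdorff
  space is closed.\<close>

lemma chart_extension_smooth:
  assumes U: "(U, \<psi>) \<in> A" and K: "compact K" "K \<subseteq> W" "W \<subseteq> \<psi> ` U" and W: "open W"
    and F: "smooth_on W F" "\<And>x. x \<notin> K \<Longrightarrow> F x = 0"
  shows "chart_extension U \<psi> F \<in> smooth_functions A"
proof (rule smooth_functionsI)
  fix V \<theta> assume V: "(V, \<theta>) \<in> A"
  have "smooth_on (- K) F"
    using K(1) F(2) by (intro smooth_on_cong[OF _ _ smooth_on_const[of _ 0]]) (auto intro: compact_imp_closed)
  then have "smooth_on (W \<union> - K) F"
    using K(1) W F(1) by (intro smooth_on_Un) (auto intro: compact_imp_closed)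
  moreover have "W \<union> - K = UNIV" using K(2) by blast
  ultimately have F_UNIV: "smooth_on UNIV F" by simp
  define K' where "K' = inv_into U \<psi> ` K"
  have "compact K'"
    unfolding K'_def using K chart_continuous_inv[OF U]
    by (intro compact_continuous_image) (auto intro: continuous_on_subset)
  then have closed: "closed K'" by (rule compact_imp_closed)
  let ?f = "chart_extension U \<psi> F \<circ> inv_into V \<theta>"
  let ?S = "\<theta> ` (V \<inter> U)" and ?T = "\<theta> ` (V - K')"
  have open_S: "open ?S" and open_T: "open ?T"
    using chart_open[OF U] chart_open[OF V] closed by (intro chart_open_map[OF V]; auto)+
  have "smooth_on ?S (\<lambda>x. F ((\<psi> \<circ> inv_into V \<theta>) x))"
    by (rule smooth_on_compose[OF open_S open_UNIV subset_UNIV F_UNIV compatible[OF V U]])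
  then have smooth_S: "smooth_on ?S ?f"
    by (rule smooth_on_cong[OF open_S, rotated])
      (auto simp: chart_extension_def chart_inv[OF V])
  have "?f x = 0" if x: "x \<in> ?T" for x
  proof -
    obtain q where q: "q \<in> V" "q \<notin> K'" "x = \<theta> q" using x by auto
    have "F (\<psi> q) = 0" if "q \<in> U"
      using F(2)[of "\<psi> q"] q(2) chart_inv[OF U that] unfolding K'_def by (metis imageI)
    then show ?thesis using q chart_inv[OF V] by (simp add: chart_extension_def)
  qed
  then have "smooth_on ?T ?f"
    by (intro smooth_on_cong[OF open_T _ smooth_on_const[of _ 0]]) simp
  with smooth_S have "smooth_on (?S \<union> ?T) ?f"
    by (intro smooth_on_Un open_S open_T)
  moreover have "K' \<subseteq> U"
    using K unfolding K'_def by (auto intro: chart_inv_mem)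
  then have "?S \<union> ?T = \<theta> ` V" by blast
  ultimately show "smooth_on (\<theta> ` V) ?f" by simp
qed

lemma tangent_spaceD:
  assumes "v \<in> tangent_space A p"
  shows "f \<notin> smooth_functions A \<Longrightarrow> v f = 0"
    and "linear_between (smooth_functions A) UNIV v"
    and "f \<in> smooth_functions A \<Longrightarrow> h \<in> smooth_functions A \<Longrightarrow> v (f * h) = f p * v h + h p * v f"
  using assms unfolding tangent_space_def by blast+

lemma tangent_space_subspace: "subspace (tangent_space A p)"
  unfolding subspace_def tangent_space_def linear_between_def
  by (auto simp: algebra_simps)

lemma tangent_const:
  assumes "v \<in> tangent_space A p"
  shows "v (\<lambda>q. c) = 0"
proof -
  have "v ((\<lambda>q. 1) * (\<lambda>q. 1)) = 1 * v (\<lambda>q. 1) + 1 * v (\<lambda>q. 1)"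
    by (rule tangent_spaceD(3)[OF assms smooth_functions_const smooth_functions_const])
  then have "v (\<lambda>q. 1) = 0" by (simp add: times_fun_def)
  moreover have "v (c *\<^sub>R (\<lambda>q. 1)) = c *\<^sub>R v (\<lambda>q. 1)"
    by (rule linear_between_scaleR[OF tangent_spaceD(2)[OF assms] smooth_functions_const])
  ultimately show ?thesis by (simp add: scaleR_fun_def)
qed

definition coord_vector :: "'a set \<Rightarrow> ('a \<Rightarrow> 'e) \<Rightarrow> 'a \<Rightarrow> 'e \<Rightarrow> 'a tvec"
  where "coord_vector U \<psi> p c = (\<lambda>f. if f \<in> smooth_functions A
    then frechet_derivative (f \<circ> inv_into U \<psi>) (at (\<psi> p)) c else 0)"

lemma chart_has_derivative:
  assumes "(U, \<psi>) \<in> A" "p \<in> U" "f \<in> smooth_functions A"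
  shows "((f \<circ> inv_into U \<psi>) has_derivative (\<lambda>c. coord_vector U \<psi> p c f)) (at (\<psi> p))"
  using smooth_on_has_derivative[OF smooth_functionsD[OF assms(3,1)] imageI[OF assms(2)]] assms(3)
  by (simp add: coord_vector_def)

lemma coord_vector_eqI:
  assumes "((f \<circ> inv_into U \<psi>) has_derivative L) (at (\<psi> p))" "f \<in> smooth_functions A"
  shows "coord_vector U \<psi> p c f = L c"
  using frechet_derivative_at[OF assms(1)] assms(2) by (simp add: coord_vector_def)

lemma coord_vector_tangent:
  assumes U: "(U, \<psi>) \<in> A" and p: "p \<in> U"
  shows "coord_vector U \<psi> p c \<in> tangent_space A p"
proof -
  let ?v = "coord_vector U \<psi> p c"
  note der = chart_has_derivative[OF U p]
  have "?v (f + h) = ?v f + ?v h"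
    if f: "f \<in> smooth_functions A" and h: "h \<in> smooth_functions A" for f h
  proof (rule coord_vector_eqI[where L = "\<lambda>c. coord_vector U \<psi> p c f + coord_vector U \<psi> p c h",
        OF _ smooth_functions_add[OF f h]])
    show "((f + h) \<circ> inv_into U \<psi> has_derivative
        (\<lambda>c. coord_vector U \<psi> p c f + coord_vector U \<psi> p c h)) (at (\<psi> p))"
      using has_derivative_add[OF der[OF f] der[OF h]] by (simp add: comp_def)
  qed
  moreover have "?v (a *\<^sub>R f) = a *\<^sub>R ?v f" if f: "f \<in> smooth_functions A" for a f
  proof (rule coord_vector_eqI[where L = "\<lambda>c. a *\<^sub>R coord_vector U \<psi> p c f",
        OF _ smooth_functions_scaleR[OF f]])
    show "((a *\<^sub>R f) \<circ> inv_into U \<psi> has_derivative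
        (\<lambda>c. a *\<^sub>R coord_vector U \<psi> p c f)) (at (\<psi> p))"
      using has_derivative_scaleR_right[OF der[OF f], of a] by (simp add: comp_def)
  qed
  moreover have "?v (f * h) = f p * ?v h + h p * ?v f"
    if f: "f \<in> smooth_functions A" and h: "h \<in> smooth_functions A" for f h
  proof (rule coord_vector_eqI[where L = "\<lambda>c. f p * coord_vector U \<psi> p c h + h p * coord_vector U \<psi> p c f",
        OF _ smooth_functions_mult[OF f h]])
    show "((f * h) \<circ> inv_into U \<psi> has_derivative
        (\<lambda>c. f p * coord_vector U \<psi> p c h + h p * coord_vector U \<psi> p c f)) (at (\<psi> p))"
      using has_derivative_mult[OF der[OF f] der[OF h]]
      by (simp add: comp_def chart_inv[OF U p] mult.commute)
  qed
  moreover have "?v f = 0" if "f \<notin> smooth_functions A" for f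
    using that by (simp add: coord_vector_def)
  ultimately show ?thesis
    unfolding tangent_space_def linear_between_def by simp
qed

lemma linear_coord_vector:
  assumes "(U, \<psi>) \<in> A" "p \<in> U"
  shows "linear (coord_vector U \<psi> p)"
proof
  have lin: "linear (\<lambda>c. coord_vector U \<psi> p c f)" if "f \<in> smooth_functions A" for f
    using chart_has_derivative[OF assms that] by (rule has_derivative_linear)
  have zero: "coord_vector U \<psi> p c f = 0" if "f \<notin> smooth_functions A" for f c
    using that by (simp add: coord_vector_def)
  show "coord_vector U \<psi> p (c + d) = coord_vector U \<psi> p c + coord_vector U \<psi> p d" for c d
  proof
    fix f show "coord_vector U \<psi> p (c + d) f = (coord_vector U \<psi> p c + coord_vector U \<psi> p d) f"
      using linear_add[OF lin] zero by (cases "f \<in> smooth_functions A") simp_all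
  qed
  show "coord_vector U \<psi> p (a *\<^sub>R c) = a *\<^sub>R coord_vector U \<psi> p c" for a c
  proof
    fix f show "coord_vector U \<psi> p (a *\<^sub>R c) f = (a *\<^sub>R coord_vector U \<psi> p c) f"
      using linear_scale[OF lin] zero by (cases "f \<in> smooth_functions A") simp_all
  qed
qed

lemma chart_ball:
  assumes "(U, \<psi>) \<in> A" "p \<in> U"
  obtains r where "r > 0" "ball (\<psi> p) (2 * r) \<subseteq> \<psi> ` U"
proof -
  obtain R where "R > 0" "ball (\<psi> p) R \<subseteq> \<psi> ` U"
    using open_contains_ball chart_image_open[OF assms(1)] assms(2) by (metis imageI)
  then show ?thesis by (intro that[of "R / 2"]) auto
qed

text \<open>With a bump function \<open>B\<close> supported in the chart, the Hadamard lemma yields the global identity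
  \<open>B\<^sup>2 (f - f p) = \<Sum>b. x b * k b\<close>, where \<open>x b\<close> is \<open>B\<close> times a coordinate centred at \<open>p\<close> and \<open>k b\<close>
  is \<open>B\<close> times a Hadamard coefficient. Apply the derivation \<open>v\<close>: since \<open>x b\<close> and \<open>f - f p\<close> vanish at
  \<open>p\<close>, only the values \<open>v (x b)\<close> and the partial derivatives of \<open>f\<close> at \<open>p\<close> survive.\<close>

lemma tangent_vector_is_coord_vector:
  assumes U: "(U, \<psi>) \<in> A" and p: "p \<in> U" and v: "v \<in> tangent_space A p"
  shows "\<exists>c. v = coord_vector U \<psi> p c"
proof -
  obtain r where r: "r > 0" and ball: "ball (\<psi> p) (2 * r) \<subseteq> \<psi> ` U"
    using chart_ball[OF U p] .
  let ?W = "ball (\<psi> p) (2 * r)" and ?\<beta> = "bump (\<psi> p) r"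
  have W: "smooth_on ?W ?\<beta>" by (rule smooth_on_subset[OF smooth_on_bump subset_UNIV])
  have ext: "chart_extension U \<psi> (\<lambda>x. ?\<beta> x * F x) \<in> smooth_functions A" if "smooth_on ?W F" for F
    using r that W by (intro chart_extension_smooth[OF U compact_cball[of "\<psi> p" r] _ ball open_ball])
      (auto intro!: smooth_on_mult bump_outside)
  define x where "x b = chart_extension U \<psi> (\<lambda>y. ?\<beta> y * ((y - \<psi> p) \<bullet> b))" for b
  have x: "x b \<in> smooth_functions A" for b
    unfolding x_def
    by (intro ext smooth_on_bounded_linear[OF bounded_linear_inner_left] smooth_on_diff
        smooth_on_id smooth_on_const open_ball)
  define B where "B = chart_extension U \<psi> (\<lambda>y. ?\<beta> y * 1)"
  have B: "B \<in> smooth_functions A" unfolding B_def by (intro ext smooth_on_const)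
  have Bp: "B p > 0" using bump_center[OF r] p by (simp add: B_def chart_extension_def)
  note v_lin = tangent_spaceD(2)[OF v]
  define c where "c = (\<Sum>b\<in>Basis. (v (x b) / B p) *\<^sub>R b)"
  have "v f = coord_vector U \<psi> p c f" for f
  proof (cases "f \<in> smooth_functions A")
    case f: True
    let ?F = "f \<circ> inv_into U \<psi>"
    have "smooth_on ?W ?F" using smooth_on_subset[OF smooth_functionsD[OF f U] ball] .
    then obtain h where h: "\<And>b. smooth_on ?W (h b)"
      "\<And>b. h b (\<psi> p) = frechet_derivative ?F (at (\<psi> p)) b"
      "\<And>y. y \<in> ?W \<Longrightarrow> ?F y = ?F (\<psi> p) + (\<Sum>b\<in>Basis. ((y - \<psi> p) \<bullet> b) * h b y)"
      using hadamard[of "\<psi> p" "2 * r" ?F] r by auto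
    define k where "k b = chart_extension U \<psi> (\<lambda>y. ?\<beta> y * h b y)" for b
    have k: "k b \<in> smooth_functions A" for b unfolding k_def by (intro ext h)
    define w where "w = f - (\<lambda>q. f p)"
    have w: "w \<in> smooth_functions A"
      unfolding w_def by (intro smooth_functions_diff f smooth_functions_const)
    have "v w = v f"
      unfolding w_def using linear_between_diff[OF v_lin smooth_functions_subspace f smooth_functions_const]
        tangent_const[OF v] by simp
    moreover have "w p = 0" by (simp add: w_def)
    ultimately have lhs: "v ((B * B) * w) = B p * B p * v f"
      using tangent_spaceD(3)[OF v smooth_functions_mult[OF B B] w] by simp
    \<comment> \<open>Two factors \<open>B\<close> are needed, one to globalise the coordinates and one for the coefficients.\<close>
    have "(B * B) * w = (\<Sum>b\<in>Basis. x b * k b)"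
    proof
      fix q
      show "((B * B) * w) q = (\<Sum>b\<in>Basis. x b * k b) q"
      proof (cases "q \<in> U \<and> \<psi> q \<in> ?W")
        case True
        then have "w q = (\<Sum>b\<in>Basis. ((\<psi> q - \<psi> p) \<bullet> b) * h b (\<psi> q))"
          using h(3)[of "\<psi> q"] chart_inv[OF U] p by (simp add: w_def)
        then show ?thesis
          using True by (simp add: sum_fun_apply B_def x_def k_def chart_extension_def
              sum_distrib_left mult_ac)
      next
        case False
        then have "B q = 0 \<and> (\<forall>b. x b q = 0)"
          using r bump_outside[of "\<psi> q" "\<psi> p" r]
          by (auto simp: B_def x_def chart_extension_def)
        then show ?thesis by (simp add: sum_fun_apply)
      qed
    qed
    moreover have "v (\<Sum>b\<in>Basis. x b * k b) = (\<Sum>b\<in>Basis. v (x b * k b))"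
      using linear_between_sum[OF v_lin smooth_functions_subspace, of Basis "\<lambda>b. x b * k b" "\<lambda>b. 1"]
        smooth_functions_mult[OF x k] by simp
    moreover have "v (x b * k b) = B p * h b (\<psi> p) * v (x b)" for b
      using tangent_spaceD(3)[OF v x k] p by (simp add: x_def k_def B_def chart_extension_def)
    ultimately have "B p * B p * v f = (\<Sum>b\<in>Basis. B p * h b (\<psi> p) * v (x b))"
      using lhs by simp
    also have "\<dots> = B p * B p * (\<Sum>b\<in>Basis. (v (x b) / B p) * h b (\<psi> p))"
      using Bp by (simp add: sum_distrib_left mult_ac)
    finally have "v f = (\<Sum>b\<in>Basis. (v (x b) / B p) * h b (\<psi> p))"
      using Bp by simp
    also have "\<dots> = (\<Sum>b\<in>Basis. (v (x b) / B p) *\<^sub>R coord_vector U \<psi> p b) f"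
      using f h(2) by (simp add: sum_fun_apply coord_vector_def)
    also have "\<dots> = coord_vector U \<psi> p c f"
      unfolding c_def linear_sum[OF linear_coord_vector[OF U p]]
        linear_scale[OF linear_coord_vector[OF U p]] ..
    finally show ?thesis .
  next
    case False
    then show ?thesis using tangent_spaceD(1)[OF v] by (simp add: coord_vector_def)
  qed
  then show ?thesis by blast
qed

lemma tangent_space_dim_le:
  "\<exists>F. finite F \<and> card F \<le> DIM('e) \<and> tangent_space A p \<subseteq> span F"
proof -
  obtain U \<psi> where U: "(U, \<psi>) \<in> A" "p \<in> U" using chart_around .
  let ?D = "coord_vector U \<psi> p"
  have "tangent_space A p \<subseteq> span (?D ` Basis)"
  proof
    fix v assume "v \<in> tangent_space A p"
    then obtain c where c: "v = ?D c" using tangent_vector_is_coord_vector[OF U] by blast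
    have "?D c = (\<Sum>b\<in>Basis. (c \<bullet> b) *\<^sub>R ?D b)"
      by (rule linear_Basis_expansion[OF linear_coord_vector[OF U]])
    also have "\<dots> \<in> span (?D ` Basis)"
      by (intro span_sum span_scale span_base imageI)
    finally show "v \<in> span (?D ` Basis)" unfolding c .
  qed
  then show ?thesis
    by (intro exI[of _ "?D ` Basis"]) (auto intro: card_image_le)
qed

lemma vector_fieldsD:
  assumes "X \<in> vector_fields A"
  shows "X p \<in> tangent_space A p"
    and "f \<in> smooth_functions A \<Longrightarrow> vderiv X f \<in> smooth_functions A"
  using assms unfolding vector_fields_def by auto

lemma vector_fieldsI:
  "(\<And>p. X p \<in> tangent_space A p) \<Longrightarrow>
    (\<And>f. f \<in> smooth_functions A \<Longrightarrow> vderiv X f \<in> smooth_functions A) \<Longrightarrow> X \<in> vector_fields A"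
  unfolding vector_fields_def by blast

text \<open>A constant-coefficient field in a chart, cut off by a bump function that is normalised at \<open>p\<close>.\<close>

lemma vector_field_extension:
  assumes v: "v \<in> tangent_space A p"
  shows "\<exists>X\<in>vector_fields A. X p = v"
proof -
  obtain U \<psi> where U: "(U, \<psi>) \<in> A" and p: "p \<in> U" using chart_around .
  obtain c where c: "v = coord_vector U \<psi> p c"
    using tangent_vector_is_coord_vector[OF U p v] by blast
  obtain r where r: "r > 0" and ball: "ball (\<psi> p) (2 * r) \<subseteq> \<psi> ` U"
    using chart_ball[OF U p] .
  let ?\<beta> = "bump (\<psi> p) r"
  define X where "X q = (if q \<in> U then (?\<beta> (\<psi> q) / ?\<beta> (\<psi> p)) *\<^sub>R coord_vector U \<psi> q c else 0)" for q
  have "X \<in> vector_fields A"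
  proof (rule vector_fieldsI)
    show "X q \<in> tangent_space A q" for q
      using subspace_scale[OF tangent_space_subspace coord_vector_tangent[OF U]]
        subspace_0[OF tangent_space_subspace] by (simp add: X_def)
    fix f assume f: "f \<in> smooth_functions A"
    let ?F = "\<lambda>x. frechet_derivative (f \<circ> inv_into U \<psi>) (at x) c / ?\<beta> (\<psi> p)"
    have F: "smooth_on (\<psi> ` U) ?F"
      using smooth_on_frechet_derivative[OF smooth_functionsD[OF f U]]
      by (intro smooth_on_bounded_linear[OF bounded_linear_divide chart_image_open[OF U]])
    have "chart_extension U \<psi> (\<lambda>x. ?\<beta> x * ?F x) \<in> smooth_functions A"
    proof (rule chart_extension_smooth[OF U compact_cball[of "\<psi> p" r] _ subset_refl chart_image_open[OF U]])
      show "cball (\<psi> p) r \<subseteq> \<psi> ` U" using ball r by force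
      show "smooth_on (\<psi> ` U) (\<lambda>x. ?\<beta> x * ?F x)"
        by (intro smooth_on_mult chart_image_open[OF U] F smooth_on_subset[OF smooth_on_bump subset_UNIV])
    qed (use r in \<open>simp add: bump_outside\<close>)
    moreover have "chart_extension U \<psi> (\<lambda>x. ?\<beta> x * ?F x) = vderiv X f"
      using f by (auto simp: vderiv_def X_def chart_extension_def coord_vector_def)
    ultimately show "vderiv X f \<in> smooth_functions A" by simp
  qed
  moreover have "X p = v"
    using p c bump_center[OF r, of "\<psi> p"] by (simp add: X_def)
  ultimately show ?thesis by blast
qed

lemma vector_fields_add: "X \<in> vector_fields A \<Longrightarrow> Y \<in> vector_fields A \<Longrightarrow> X + Y \<in> vector_fields A"
  using smooth_functions_add[OF vector_fieldsD(2) vector_fieldsD(2)]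
  by (intro vector_fieldsI)
    (auto simp: vderiv_def plus_fun_def intro: subspace_add[OF tangent_space_subspace, unfolded plus_fun_def] vector_fieldsD)

lemma vector_fields_fmul:
  assumes "f \<in> smooth_functions A" "X \<in> vector_fields A" shows "f \<odot> X \<in> vector_fields A"
proof (rule vector_fieldsI)
  show "(f \<odot> X) p \<in> tangent_space A p" for p
    using subspace_scale[OF tangent_space_subspace vector_fieldsD(1)[OF assms(2)]]
    by (simp add: fmul_def)
  fix h assume "h \<in> smooth_functions A"
  then have "f * vderiv X h \<in> smooth_functions A"
    by (intro smooth_functions_mult assms vector_fieldsD)
  then show "vderiv (f \<odot> X) h \<in> smooth_functions A"
    by (simp add: vderiv_def fmul_def times_fun_def)
qed

lemma scaleR_eq_fmul: "c *\<^sub>R X = (\<lambda>p. c) \<odot> X"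
  by (simp add: fmul_def scaleR_fun_def)

lemma vector_fields_scaleR: "X \<in> vector_fields A \<Longrightarrow> c *\<^sub>R X \<in> vector_fields A"
  unfolding scaleR_eq_fmul by (intro vector_fields_fmul smooth_functions_const)

lemma vector_fields_diff:
  assumes "X \<in> vector_fields A" "Y \<in> vector_fields A" shows "X - Y \<in> vector_fields A"
  using vector_fields_add[OF assms(1) vector_fields_scaleR[OF assms(2), of "- 1"]] by simp

lemma lie_bracket_apply: "lie_bracket X Y p f = X p (vderiv Y f) - Y p (vderiv X f)"
  by (simp add: lie_bracket_def)

lemma vderiv_lie_bracket: "vderiv (lie_bracket X Y) f = vderiv X (vderiv Y f) - vderiv Y (vderiv X f)"
  by (simp add: vderiv_def lie_bracket_apply fun_eq_iff)

lemma vderiv_add: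
  "X \<in> vector_fields A \<Longrightarrow> f \<in> smooth_functions A \<Longrightarrow> h \<in> smooth_functions A \<Longrightarrow>
    vderiv X (f + h) = vderiv X f + vderiv X h"
  using linear_between_add[OF tangent_spaceD(2)[OF vector_fieldsD(1)]]
  by (auto simp: vderiv_def fun_eq_iff)

lemma vderiv_scaleR:
  "X \<in> vector_fields A \<Longrightarrow> f \<in> smooth_functions A \<Longrightarrow> vderiv X (c *\<^sub>R f) = c *\<^sub>R vderiv X f"
  using linear_between_scaleR[OF tangent_spaceD(2)[OF vector_fieldsD(1)]]
  by (auto simp: vderiv_def fun_eq_iff)

lemma vderiv_diff:
  "X \<in> vector_fields A \<Longrightarrow> f \<in> smooth_functions A \<Longrightarrow> h \<in> smooth_functions A \<Longrightarrow>
    vderiv X (f - h) = vderiv X f - vderiv X h"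
  using vderiv_add[of X f "- 1 *\<^sub>R h"] vderiv_scaleR[of X h "- 1"] smooth_functions_scaleR[of h "- 1"]
  by simp

lemma vderiv_mult:
  "X \<in> vector_fields A \<Longrightarrow> f \<in> smooth_functions A \<Longrightarrow> h \<in> smooth_functions A \<Longrightarrow>
    vderiv X (f * h) = f * vderiv X h + h * vderiv X f"
  using tangent_spaceD(3)[OF vector_fieldsD(1)]
  by (auto simp: vderiv_def fun_eq_iff)

lemma vderiv_const: "X \<in> vector_fields A \<Longrightarrow> vderiv X (\<lambda>p. c) = 0"
  using tangent_const[OF vector_fieldsD(1)] by (auto simp: vderiv_def fun_eq_iff)

lemma vderiv_nonsmooth: "X \<in> vector_fields A \<Longrightarrow> f \<notin> smooth_functions A \<Longrightarrow> vderiv X f = 0"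
  using tangent_spaceD(1)[OF vector_fieldsD(1)] by (auto simp: vderiv_def fun_eq_iff)

lemma vector_fields_lie_bracket:
  assumes X: "X \<in> vector_fields A" and Y: "Y \<in> vector_fields A"
  shows "lie_bracket X Y \<in> vector_fields A"
proof (rule vector_fieldsI)
  let ?L = "lie_bracket X Y"
  note smooth = vector_fieldsD(2)[OF X] vector_fieldsD(2)[OF Y]
    smooth_functions_mult smooth_functions_add
  fix p :: 'a
  have at: "Z p u = vderiv Z u p" for Z u by (simp add: vderiv_def)
  have "?L p (f + h) = ?L p f + ?L p h"
    if "f \<in> smooth_functions A" "h \<in> smooth_functions A" for f h
    using that X Y by (simp add: at vderiv_lie_bracket vderiv_add smooth)
  moreover have "?L p (c *\<^sub>R f) = c *\<^sub>R ?L p f" if "f \<in> smooth_functions A" for c f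
    using that X Y by (simp add: at vderiv_lie_bracket vderiv_scaleR smooth algebra_simps)
  moreover have "?L p (f * h) = f p * ?L p h + h p * ?L p f"
    if "f \<in> smooth_functions A" "h \<in> smooth_functions A" for f h
    using that X Y by (simp add: at vderiv_lie_bracket vderiv_mult vderiv_add smooth algebra_simps)
  moreover have "?L p f = 0" if "f \<notin> smooth_functions A" for f
    using that X Y vderiv_const[of _ 0]
    by (simp add: at vderiv_lie_bracket vderiv_nonsmooth zero_fun_def)
  ultimately show "?L p \<in> tangent_space A p"
    unfolding tangent_space_def linear_between_def by simp
next
  fix f assume "f \<in> smooth_functions A"
  then show "vderiv (lie_bracket X Y) f \<in> smooth_functions A"
    unfolding vderiv_lie_bracket by (intro smooth_functions_diff vector_fieldsD(2) X Y)
qed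

text \<open>On smooth functions the twelve third-order terms cancel in pairs; on all other functions the
  brackets vanish by the normalisation of tangent vectors.\<close>

lemma jacobi:
  assumes X: "X \<in> vector_fields A" and Y: "Y \<in> vector_fields A" and Z: "Z \<in> vector_fields A"
  shows "lie_bracket X (lie_bracket Y Z) + lie_bracket Y (lie_bracket Z X)
    + lie_bracket Z (lie_bracket X Y) = 0"
proof (intro ext)
  fix p :: 'a and f :: "'a \<Rightarrow> real"
  have at: "W p u = vderiv W u p" for W u by (simp add: vderiv_def)
  note smooth = vector_fieldsD(2)[OF X] vector_fieldsD(2)[OF Y] vector_fieldsD(2)[OF Z]
  show "(lie_bracket X (lie_bracket Y Z) + lie_bracket Y (lie_bracket Z X)
    + lie_bracket Z (lie_bracket X Y)) p f = 0 p f"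
  proof (cases "f \<in> smooth_functions A")
    case True
    then show ?thesis
      using X Y Z by (simp add: at vderiv_lie_bracket vderiv_diff smooth)
  next
    case False
    have "W p f = 0" if "W \<in> vector_fields A" for W
      using vderiv_nonsmooth[OF that False] by (simp add: at)
    from this[OF vector_fields_lie_bracket[OF X vector_fields_lie_bracket[OF Y Z]]]
      this[OF vector_fields_lie_bracket[OF Y vector_fields_lie_bracket[OF Z X]]]
      this[OF vector_fields_lie_bracket[OF Z vector_fields_lie_bracket[OF X Y]]]
    show ?thesis by simp
  qed
qed

end

section \<open>Curvature tensors on a vector space of dimension at most three\<close>

context
  fixes V F :: "'v::real_vector set"
  assumes V: "subspace V" and F: "finite F" "V \<subseteq> span F"
begin

text \<open>The set of admissible bases is non-empty and its members are finite, so the choice in the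
  definition of the trace really yields a basis. The traces evaluated below are of multiples of the
  identity and of operators of rank one, on which all bases visibly agree.\<close>

lemma trace_on_basis:
  obtains B where "finite B" "independent B" "span B = V"
    "\<And>T. trace_on V T = (\<Sum>b\<in>B. representation B (T b) b)"
proof -
  obtain B0 where "B0 \<subseteq> V" "independent B0" "V \<subseteq> span B0"
    using maximal_independent_subset .
  then have ex: "\<exists>B. B \<subseteq> V \<and> independent B \<and> span B = V"
    by (intro exI[of _ B0]) (auto simp: span_minimal V subset_antisym)
  define B where "B = (SOME B. B \<subseteq> V \<and> independent B \<and> span B = V)"
  have B: "B \<subseteq> V" "independent B" "span B = V"
    using someI_ex[OF ex] unfolding B_def by auto
  have "finite B"
    using independent_span_bound[OF F(1) B(2)] B(1) F(2) by auto
  with B that show ?thesis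
    by (simp add: trace_on_def B_def Let_def)
qed

lemma trace_on_add:
  assumes "\<And>x. x \<in> V \<Longrightarrow> T x \<in> V" "\<And>x. x \<in> V \<Longrightarrow> T' x \<in> V"
  shows "trace_on V (\<lambda>x. T x + T' x) = trace_on V T + trace_on V T'"
proof -
  obtain B where B: "finite B" "independent B" "span B = V"
    "\<And>T. trace_on V T = (\<Sum>b\<in>B. representation B (T b) b)"
    using trace_on_basis by blast
  then have "b \<in> V" if "b \<in> B" for b using that span_base by blast
  with assms B show ?thesis
    by (simp add: representation_add sum.distrib)
qed

lemma trace_on_scaleR:
  assumes "\<And>x. x \<in> V \<Longrightarrow> T x \<in> V"
  shows "trace_on V (\<lambda>x. c *\<^sub>R T x) = c * trace_on V T"
proof -
  obtain B where B: "finite B" "independent B" "span B = V"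
    "\<And>T. trace_on V T = (\<Sum>b\<in>B. representation B (T b) b)"
    using trace_on_basis by blast
  then have "b \<in> V" if "b \<in> B" for b using that span_base by blast
  with assms B show ?thesis
    by (simp add: representation_scale sum_distrib_left)
qed

lemma trace_on_rank_one:
  assumes "linear_between V UNIV \<omega>" "u \<in> V"
  shows "trace_on V (\<lambda>x. \<omega> x *\<^sub>R u) = \<omega> u"
proof -
  obtain B where B: "finite B" "independent B" "span B = V"
    "\<And>T. trace_on V T = (\<Sum>b\<in>B. representation B (T b) b)"
    using trace_on_basis by blast
  have "\<omega> u = \<omega> (\<Sum>b\<in>B. representation B u b *\<^sub>R b)"
    using sum_representation_eq[of B u B] B assms(2) by simp
  also have "\<dots> = (\<Sum>b\<in>B. representation B u b *\<^sub>R \<omega> b)"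
    using B span_base by (intro linear_between_sum[OF assms(1) V]) blast
  finally show ?thesis
    using B assms(2) by (simp add: representation_scale mult.commute)
qed

lemma trace_on_cong: "(\<And>x. x \<in> V \<Longrightarrow> T x = T' x) \<Longrightarrow> trace_on V T = trace_on V T'"
proof -
  obtain B where B: "finite B" "independent B" "span B = V"
    "\<And>T. trace_on V T = (\<Sum>b\<in>B. representation B (T b) b)"
    using trace_on_basis by blast
  then have "b \<in> V" if "b \<in> B" for b using that span_base by blast
  moreover assume "\<And>x. x \<in> V \<Longrightarrow> T x = T' x"
  ultimately show ?thesis using B by simp
qed

text \<open>Complete \<open>\<xi>\<close> to a basis. When the dimension is below three the missing vectors are replaced by zero,
  with zero coordinates, so the frame always spans but need not be independent.\<close>

lemma frame_through_vector:
  assumes "card F \<le> 3" "\<xi> \<in> V" "\<xi> \<noteq> 0"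
  obtains e1 e2 \<omega>0 \<omega>1 \<omega>2 where "e1 \<in> V" "e2 \<in> V"
    "linear_between V UNIV \<omega>0" "linear_between V UNIV \<omega>1" "linear_between V UNIV \<omega>2"
    "\<And>x. x \<in> V \<Longrightarrow> x = \<omega>0 x *\<^sub>R \<xi> + \<omega>1 x *\<^sub>R e1 + \<omega>2 x *\<^sub>R (e2 :: 'v)"
proof -
  obtain B where B: "{\<xi>} \<subseteq> B" "B \<subseteq> V" "independent B" "V \<subseteq> span B"
    using maximal_independent_subset_extend[of "{\<xi>}" V] assms by auto
  have fin: "finite B" and "card B \<le> card F"
    using independent_span_bound[OF F(1) B(3)] B(2) F(2) by auto
  then have card: "card (B - {\<xi>}) \<le> 2" using assms(1) B(1) by simp
  have rep: "linear_between V UNIV (\<lambda>x. representation B x b)" for b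
    using B V by (auto simp: linear_between_def representation_add representation_scale subset_iff)
  have zero: "linear_between V UNIV (\<lambda>x. 0::real)"
    by (simp add: linear_between_def)
  have expand: "x = representation B x \<xi> *\<^sub>R \<xi> + (\<Sum>b\<in>B - {\<xi>}. representation B x b *\<^sub>R b)"
    if "x \<in> V" for x
    using sum_representation_eq[of B x B] B fin that sum.remove[OF fin, of \<xi> "\<lambda>b. representation B x b *\<^sub>R b"]
    by auto
  consider "card (B - {\<xi>}) = 0" | "card (B - {\<xi>}) = 1" | "card (B - {\<xi>}) = 2"
    using card by linarith
  then show ?thesis
  proof cases
    case 1
    then have "B - {\<xi>} = {}" using fin by simp
    with expand show ?thesis
      using V subspace_0[OF V] by (intro that[OF _ _ rep[of \<xi>] zero zero, of 0 0]) auto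
  next
    case 2
    then obtain a where "B - {\<xi>} = {a}" by (rule card_1_singletonE)
    moreover from this have "a \<in> V" using B(2) by blast
    ultimately show ?thesis
      using expand V subspace_0[OF V] by (intro that[OF _ _ rep[of \<xi>] rep[of a] zero, of a 0]) auto
  next
    case 3
    then obtain a b where ab: "B - {\<xi>} = {a, b}" "a \<noteq> b" by (auto simp: card_2_iff)
    moreover from this have "a \<in> V" "b \<in> V" using B(2) by blast+
    ultimately show ?thesis
      using expand by (intro that[OF _ _ rep[of \<xi>] rep[of a] rep[of b], of a b]) (auto simp: add.assoc)
  qed
qed

end

text \<open>The curvature of a para Sasakian manifold in one tangent space \<open>V\<close>, reduced to pure linear algebra.\<close>

locale para_sasakian_curvature_tensor =
  fixes V :: "'v::real_vector set" and g :: "'v \<Rightarrow> 'v \<Rightarrow> real"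
    and \<xi> :: 'v and \<eta> :: "'v \<Rightarrow> real" and \<epsilon> :: real
    and R :: "'v \<Rightarrow> 'v \<Rightarrow> 'v \<Rightarrow> 'v"
  assumes V: "subspace V"
    and dim3: "\<exists>F. finite F \<and> card F \<le> 3 \<and> V \<subseteq> span F"
    and g_linear: "x \<in> V \<Longrightarrow> linear_between V UNIV (g x)"
    and g_sym: "x \<in> V \<Longrightarrow> y \<in> V \<Longrightarrow> g x y = g y x"
    and g_nondegenerate: "x \<in> V \<Longrightarrow> (\<And>y. y \<in> V \<Longrightarrow> g x y = 0) \<Longrightarrow> x = 0"
    and xi: "\<xi> \<in> V"
    and eta_linear: "linear_between V UNIV \<eta>"
    and eta_xi: "\<eta> \<xi> = 1"
    and g_xi: "x \<in> V \<Longrightarrow> g x \<xi> = \<epsilon> * \<eta> x"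
    and eps: "\<epsilon> * \<epsilon> = 1"
    and R_linear: "x \<in> V \<Longrightarrow> y \<in> V \<Longrightarrow> linear_between V V (R x y)"
    and R_skew: "x \<in> V \<Longrightarrow> y \<in> V \<Longrightarrow> z \<in> V \<Longrightarrow> R y x z = - R x y z"
    and R_skew_adjoint: "x \<in> V \<Longrightarrow> y \<in> V \<Longrightarrow> z \<in> V \<Longrightarrow> w \<in> V \<Longrightarrow> g (R x y z) w = - g z (R x y w)"
    and R_pair: "x \<in> V \<Longrightarrow> y \<in> V \<Longrightarrow> z \<in> V \<Longrightarrow> w \<in> V \<Longrightarrow> g (R x y z) w = g (R z w x) y"
    and R_xi: "x \<in> V \<Longrightarrow> y \<in> V \<Longrightarrow> R x y \<xi> = \<eta> x *\<^sub>R y - \<eta> y *\<^sub>R x"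
begin

lemmas V_intros = subspace_add[OF V] subspace_scale[OF V] subspace_diff[OF V] subspace_neg[OF V]
  subspace_0[OF V]

lemmas R_mem [intro] = linear_between_mem[OF R_linear]

lemma eps_mult: "\<epsilon> * (\<epsilon> * a) = a"
  using eps by (simp add: mult.assoc[symmetric])

lemma g_eqI: "x \<in> V \<Longrightarrow> y \<in> V \<Longrightarrow> (\<And>w. w \<in> V \<Longrightarrow> g x w = g y w) \<Longrightarrow> x = y"
  using g_nondegenerate[of "x - y"] linear_between_diff[OF g_linear V] V_intros
  by (simp add: g_sym[of "x - y"]) (simp add: g_sym)

lemma g_add_right: "x \<in> V \<Longrightarrow> y \<in> V \<Longrightarrow> z \<in> V \<Longrightarrow> g x (y + z) = g x y + g x z"
  by (rule linear_between_add[OF g_linear])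

lemma g_scaleR_right: "x \<in> V \<Longrightarrow> y \<in> V \<Longrightarrow> g x (c *\<^sub>R y) = c * g x y"
  using linear_between_scaleR[OF g_linear] by simp

lemma g_diff_right: "x \<in> V \<Longrightarrow> y \<in> V \<Longrightarrow> z \<in> V \<Longrightarrow> g x (y - z) = g x y - g x z"
  by (rule linear_between_diff[OF g_linear V])

lemma g_add_left: "x \<in> V \<Longrightarrow> y \<in> V \<Longrightarrow> z \<in> V \<Longrightarrow> g (y + z) x = g y x + g z x"
  using g_add_right[of x y z] g_sym V_intros by simp

lemma g_scaleR_left: "x \<in> V \<Longrightarrow> y \<in> V \<Longrightarrow> g (c *\<^sub>R y) x = c * g y x"
  using g_scaleR_right[of x y] g_sym V_intros by simp

lemma g_diff_left: "x \<in> V \<Longrightarrow> y \<in> V \<Longrightarrow> z \<in> V \<Longrightarrow> g (y - z) x = g y x - g z x"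
  using g_diff_right[of x y z] g_sym V_intros by simp

lemmas g_bilinear = g_add_right g_scaleR_right g_diff_right g_add_left g_scaleR_left g_diff_left

text \<open>Pair symmetry carries linearity over from the third argument.\<close>

lemma R_linear_left:
  assumes "y \<in> V" "z \<in> V"
  shows "linear_between V V (\<lambda>x. R x y z)"
  unfolding linear_between_def
proof (intro conjI ballI allI)
  show "(\<lambda>x. R x y z) ` V \<subseteq> V" using assms by auto
  show "R (v + w) y z = R v y z + R w y z" if "v \<in> V" "w \<in> V" for v w
    using that assms linear_between_add[OF R_linear[OF assms(2)]]
    by (intro g_eqI) (auto simp: V_intros R_pair g_bilinear R_mem)
  show "R (c *\<^sub>R v) y z = c *\<^sub>R R v y z" if "v \<in> V" for v c
    using that assms linear_between_scaleR[OF R_linear[OF assms(2)]]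
    by (intro g_eqI) (auto simp: V_intros R_pair g_bilinear R_mem)
qed

text \<open>The deviation of \<open>R\<close> from the curvature tensor of constant curvature \<open>- \<epsilon>\<close>.\<close>

definition C :: "'v \<Rightarrow> 'v \<Rightarrow> 'v \<Rightarrow> 'v"
  where "C x y z = R x y z + \<epsilon> *\<^sub>R (g y z *\<^sub>R x - g x z *\<^sub>R y)"

lemma C_mem: "x \<in> V \<Longrightarrow> y \<in> V \<Longrightarrow> z \<in> V \<Longrightarrow> C x y z \<in> V"
  unfolding C_def by (intro V_intros R_mem)

lemma C_linear_left:
  assumes "y \<in> V" "z \<in> V"
  shows "linear_between V V (\<lambda>x. C x y z)"
  unfolding linear_between_def
proof (intro conjI ballI allI)
  show "(\<lambda>x. C x y z) ` V \<subseteq> V" using assms C_mem by auto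
  show "C (v + w) y z = C v y z + C w y z" if "v \<in> V" "w \<in> V" for v w
    using that assms linear_between_add[OF R_linear_left[OF assms]]
    by (auto simp: C_def g_bilinear algebra_simps)
  show "C (c *\<^sub>R v) y z = c *\<^sub>R C v y z" if "v \<in> V" for v c
    using that assms linear_between_scaleR[OF R_linear_left[OF assms]]
    by (auto simp: C_def g_bilinear algebra_simps)
qed

lemma C_skew: "x \<in> V \<Longrightarrow> y \<in> V \<Longrightarrow> z \<in> V \<Longrightarrow> C y x z = - C x y z"
  by (simp add: C_def R_skew[of x y] algebra_simps)

lemma C_xi: "x \<in> V \<Longrightarrow> y \<in> V \<Longrightarrow> C x y \<xi> = 0"
  by (simp add: C_def R_xi g_xi algebra_simps eps_mult)

lemma C_xi_left:
  assumes "y \<in> V" "z \<in> V"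
  shows "C \<xi> y z = 0"
proof (rule g_nondegenerate)
  show "C \<xi> y z \<in> V" using assms xi by (intro C_mem)
  fix w assume "w \<in> V"
  with assms xi show "g (C \<xi> y z) w = 0"
    by (simp add: C_def g_bilinear V_intros R_mem R_pair[of \<xi>] R_xi g_sym[of \<xi>] g_xi
        algebra_simps eps_mult g_sym[of y])
qed

lemma eta_C:
  assumes "x \<in> V" "y \<in> V" "z \<in> V"
  shows "\<eta> (C x y z) = 0"
proof -
  have "g (C x y z) \<xi> = g (R x y z) \<xi> + \<epsilon> * (g y z * g x \<xi> - g x z * g y \<xi>)"
    unfolding C_def using assms xi by (simp add: g_bilinear V_intros R_mem)
  also have "\<dots> = 0"
    unfolding R_skew_adjoint[OF assms xi] using assms xi
    by (simp add: R_xi g_bilinear V_intros g_xi algebra_simps eps_mult g_sym[of z])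
  finally have "g (C x y z) \<xi> = 0" .
  then show ?thesis
    using g_xi[OF C_mem[OF assms]] eps by auto
qed

definition S :: "'v \<Rightarrow> 'v \<Rightarrow> real"
  where "S y z = trace_on V (\<lambda>x. R x y z)"

definition C_trace :: "'v \<Rightarrow> 'v \<Rightarrow> real"
  where "C_trace y z = trace_on V (\<lambda>x. C x y z)"

text \<open>The dimension of \<open>V\<close>, in the form in which it enters the Ricci tensor.\<close>

definition tr_id :: real where "tr_id = trace_on V (\<lambda>x. x)"

lemma S_eq:
  assumes "y \<in> V" "z \<in> V"
  shows "S y z = C_trace y z - \<epsilon> * (tr_id - 1) * g y z"
proof -
  obtain F where F: "finite F" "V \<subseteq> span F" using dim3 by auto
  note tr = V F
  have lin: "linear_between V UNIV (\<lambda>x. \<epsilon> * g x z)"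
    using assms by (auto simp: linear_between_def g_bilinear algebra_simps)
  have "S y z = trace_on V (\<lambda>x. C x y z + ((- \<epsilon> * g y z) *\<^sub>R x + (\<epsilon> * g x z) *\<^sub>R y))"
    unfolding S_def by (rule arg_cong[where f = "trace_on V"]) (auto simp: C_def algebra_simps)
  also have "\<dots> = C_trace y z + (trace_on V (\<lambda>x. (- \<epsilon> * g y z) *\<^sub>R x) + trace_on V (\<lambda>x. (\<epsilon> * g x z) *\<^sub>R y))"
    unfolding C_trace_def using assms
    by (simp only: trace_on_add[OF tr] V_intros C_mem)
  also have "\<dots> = C_trace y z + (- \<epsilon> * g y z * tr_id + \<epsilon> * g y z)"
    using trace_on_scaleR[OF tr, of "\<lambda>x. x" "- \<epsilon> * g y z"] trace_on_rank_one[OF tr lin assms(1)]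
    by (simp add: tr_id_def)
  finally show ?thesis by (simp add: algebra_simps)
qed

text \<open>In a frame \<open>\<xi>, e1, e2\<close> the skew form \<open>C x y z\<close> is the coordinate minor
  \<open>\<omega>1 x * \<omega>2 y - \<omega>2 x * \<omega>1 y\<close> times \<open>u = C e1 e2 z\<close>, since \<open>\<xi>\<close> is annihilated. Its trace in \<open>x\<close>
  is the same minor of \<open>u\<close> and \<open>y\<close>. If it vanishes for all \<open>y\<close>, then \<open>C x y z\<close> has no \<open>e1\<close> and \<open>e2\<close>
  component; it has no \<open>\<xi>\<close> component either, because \<open>\<eta>\<close> annihilates the values of \<open>C\<close>.\<close>

lemma C_eq_0_if_traceless:
  assumes traceless: "\<And>y z. y \<in> V \<Longrightarrow> z \<in> V \<Longrightarrow> C_trace y z = 0"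
    and mem: "x \<in> V" "y \<in> V" "z \<in> V"
  shows "C x y z = 0"
proof -
  obtain F where F: "finite F" "V \<subseteq> span F" "card F \<le> 3" using dim3 by auto
  have "\<xi> \<noteq> 0"
    using eta_xi linear_between_zero[OF eta_linear subspace_0[OF V]] by auto
  then obtain e1 e2 \<omega>0 \<omega>1 \<omega>2 where e: "e1 \<in> V" "e2 \<in> V"
    and lin: "linear_between V UNIV \<omega>0" "linear_between V UNIV \<omega>1" "linear_between V UNIV \<omega>2"
    and frame: "\<And>x. x \<in> V \<Longrightarrow> x = \<omega>0 x *\<^sub>R \<xi> + \<omega>1 x *\<^sub>R e1 + \<omega>2 x *\<^sub>R e2"
    using frame_through_vector[OF V F xi] by blast
  define u where "u = C e1 e2 z"
  have u: "u \<in> V" unfolding u_def using e mem by (intro C_mem)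
  have expand: "C x y z = \<omega>1 x *\<^sub>R C e1 y z + \<omega>2 x *\<^sub>R C e2 y z" if "x \<in> V" "y \<in> V" for x y
  proof -
    have "C x y z = C (\<omega>0 x *\<^sub>R \<xi> + \<omega>1 x *\<^sub>R e1 + \<omega>2 x *\<^sub>R e2) y z"
      using frame[OF that(1)] by simp
    also have "\<dots> = \<omega>0 x *\<^sub>R C \<xi> y z + \<omega>1 x *\<^sub>R C e1 y z + \<omega>2 x *\<^sub>R C e2 y z"
      using linear_between_add[OF C_linear_left] linear_between_scaleR[OF C_linear_left]
        xi e that mem by (simp add: V_intros)
    finally show ?thesis using C_xi_left that mem by simp
  qed
  have self: "C v v z = 0" if "v \<in> V" for v
    using C_skew[OF that that mem(3)] scaleR_2[of "C v v z"]
    by (simp add: eq_neg_iff_add_eq_0)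
  have C_u: "C x y z = (\<omega>1 x * \<omega>2 y - \<omega>2 x * \<omega>1 y) *\<^sub>R u" if "x \<in> V" "y \<in> V" for x y
  proof -
    have "C e1 y z = - (\<omega>1 y *\<^sub>R C e1 e1 z + \<omega>2 y *\<^sub>R C e2 e1 z)"
      using C_skew[OF that(2) e(1) mem(3)] expand[OF that(2) e(1)] by simp
    then have 1: "C e1 y z = \<omega>2 y *\<^sub>R u"
      using C_skew[OF e(1) e(2) mem(3)] self e by (simp add: u_def)
    have "C e2 y z = - (\<omega>1 y *\<^sub>R C e1 e2 z + \<omega>2 y *\<^sub>R C e2 e2 z)"
      using C_skew[OF that(2) e(2) mem(3)] expand[OF that(2) e(2)] by simp
    then have 2: "C e2 y z = - \<omega>1 y *\<^sub>R u"
      using self e by (simp add: u_def)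
    show ?thesis
      using expand[OF that] unfolding 1 2 by (simp add: algebra_simps)
  qed
  have trace0: "\<omega>1 u * \<omega>2 y = \<omega>2 u * \<omega>1 y" if "y \<in> V" for y
  proof -
    have "linear_between V UNIV (\<lambda>x. \<omega>1 x * \<omega>2 y - \<omega>2 x * \<omega>1 y)"
      using linear_between_add[OF lin(2)] linear_between_add[OF lin(3)]
        linear_between_scaleR[OF lin(2)] linear_between_scaleR[OF lin(3)]
      by (auto simp: linear_between_def algebra_simps)
    from trace_on_rank_one[OF V F(1,2) this u] have "C_trace y z = \<omega>1 u * \<omega>2 y - \<omega>2 u * \<omega>1 y"
      unfolding C_trace_def using trace_on_cong[OF V F(1,2) C_u[OF _ that]] by simp
    then show ?thesis using traceless[OF that mem(3)] by simp
  qed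
  \<comment> \<open>As the frame may be dependent, one cannot evaluate the trace at dual vectors; instead the minor
      \<open>d\<close> itself kills both coordinates of \<open>u\<close>.\<close>
  define d where "d = \<omega>1 x * \<omega>2 y - \<omega>2 x * \<omega>1 y"
  have "d * \<omega>1 u = \<omega>1 x * (\<omega>1 u * \<omega>2 y) - \<omega>1 y * (\<omega>1 u * \<omega>2 x)"
    by (simp add: d_def algebra_simps)
  also have "\<dots> = 0" unfolding trace0[OF mem(1)] trace0[OF mem(2)] by (simp add: algebra_simps)
  finally have d1: "d * \<omega>1 u = 0" .
  have "d * \<omega>2 u = \<omega>2 y * (\<omega>2 u * \<omega>1 x) - \<omega>2 x * (\<omega>2 u * \<omega>1 y)"
    by (simp add: d_def algebra_simps)
  also have "\<dots> = 0"
    unfolding trace0[OF mem(1), symmetric] trace0[OF mem(2), symmetric] by (simp add: algebra_simps)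
  finally have d2: "d * \<omega>2 u = 0" .
  have "C x y z = d *\<^sub>R (\<omega>0 u *\<^sub>R \<xi> + \<omega>1 u *\<^sub>R e1 + \<omega>2 u *\<^sub>R e2)"
    using C_u[OF mem(1,2)] frame[OF u] by (simp add: d_def)
  also have "\<dots> = (d * \<omega>0 u) *\<^sub>R \<xi>"
    by (simp add: scaleR_add_right d1 d2)
  finally have eq: "C x y z = (d * \<omega>0 u) *\<^sub>R \<xi>" .
  then have "d * \<omega>0 u = 0"
    using eta_C[OF mem] linear_between_scaleR[OF eta_linear xi] eta_xi by simp
  with eq show ?thesis by simp
qed

text \<open>Put \<open>x = v = \<xi>\<close> in the semi-symmetry condition. Both \<open>S (R \<xi> v u) \<xi>\<close> and \<open>S u \<xi>\<close> are known
  because \<open>C\<close> vanishes on \<open>\<xi>\<close>, which leaves \<open>S u v = - \<epsilon> * (tr_id - 1) * g u v\<close>. This is the Ricci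
  tensor of constant curvature \<open>- \<epsilon>\<close>, so \<open>C\<close> is traceless.\<close>

theorem constant_curvature:
  assumes semi: "\<And>x y u v. x \<in> V \<Longrightarrow> y \<in> V \<Longrightarrow> u \<in> V \<Longrightarrow> v \<in> V \<Longrightarrow>
      S (R x y u) v + S u (R x y v) = 0"
    and mem: "x \<in> V" "y \<in> V" "z \<in> V"
  shows "R x y z = (- \<epsilon>) *\<^sub>R (g y z *\<^sub>R x - g x z *\<^sub>R y)"
proof -
  obtain F where F: "finite F" "V \<subseteq> span F" using dim3 by auto
  have S_xi: "S u \<xi> = - \<epsilon> * (tr_id - 1) * g u \<xi>" if "u \<in> V" for u
  proof -
    have "C_trace u \<xi> = trace_on V (\<lambda>x. 0 *\<^sub>R x)"
      unfolding C_trace_def using C_xi that by (intro trace_on_cong[OF V F]) auto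
    also have "\<dots> = 0" using trace_on_scaleR[OF V F, of "\<lambda>x. x" 0] by simp
    finally show ?thesis using S_eq[OF that xi] by simp
  qed
  have "C_trace u v = 0" if "u \<in> V" "v \<in> V" for u v
  proof -
    have "S u (R \<xi> v \<xi>) = trace_on V (\<lambda>x. R x u v + (- \<eta> v) *\<^sub>R R x u \<xi>)"
      unfolding S_def
    proof (intro trace_on_cong[OF V F])
      fix x assume "x \<in> V"
      then show "R x u (R \<xi> v \<xi>) = R x u v + (- \<eta> v) *\<^sub>R R x u \<xi>"
        using that xi eta_xi linear_between_diff[OF R_linear[OF _ that(1)] V, of x v "\<eta> v *\<^sub>R \<xi>"]
          linear_between_scaleR[OF R_linear[OF _ that(1)], of x \<xi> "\<eta> v"]
        by (simp add: R_xi[OF xi that(2)] V_intros)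
    qed
    also have "\<dots> = S u v - \<eta> v * S u \<xi>"
      unfolding S_def using that xi trace_on_scaleR[OF V F, of "\<lambda>x. R x u \<xi>" "- \<eta> v"]
      by (subst trace_on_add[OF V F]) (auto intro: V_intros R_mem)
    finally have 1: "S u (R \<xi> v \<xi>) = S u v - \<eta> v * S u \<xi>" .
    have g_R: "g (R \<xi> v u) \<xi> = - (g u v - \<eta> v * g u \<xi>)"
      using that xi eta_xi by (simp add: R_skew_adjoint[of \<xi> v u \<xi>] R_xi g_bilinear V_intros)
    then have 2: "S (R \<xi> v u) \<xi> = \<epsilon> * (tr_id - 1) * (g u v - \<eta> v * g u \<xi>)"
      unfolding S_xi[OF R_mem[OF xi that(2,1)]] g_R by (simp only: mult_minus_left mult_minus_right minus_minus)
    have "S u v = - \<epsilon> * (tr_id - 1) * g u v"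
      using semi[OF xi that(2) that(1) xi] unfolding 1 2 S_xi[OF that(1)]
      by (simp add: algebra_simps)
    then show ?thesis using S_eq[OF that] by simp
  qed
  then have "C x y z = 0" by (rule C_eq_0_if_traceless[OF _ mem])
  then show ?thesis
    unfolding C_def scaleR_minus_left by (rule eq_neg_iff_add_eq_0[THEN iffD2])
qed

end

section \<open>Curvature of the Levi-Civita connection\<close>

locale levi_civita_manifold = smooth_manifold A
  for A :: "('a::{t2_space,second_countable_topology}, 'e::euclidean_space) atlas" +
  fixes g :: "'a bilinear_field" and D :: "'a connection"
  assumes semi_riemannian: "semi_riemannian_metric A g"
    and connection: "levi_civita_connection A g D"
begin

abbreviation G where "G \<equiv> app_bilinear g"
abbreviation R where "R \<equiv> curvature D"

lemma g_bilinear_field: "smooth_bilinear_field A g"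
  and g_sym: "v \<in> tangent_space A p \<Longrightarrow> w \<in> tangent_space A p \<Longrightarrow> g p v w = g p w v"
  and g_nondegenerate: "v \<in> tangent_space A p \<Longrightarrow> (\<And>w. w \<in> tangent_space A p \<Longrightarrow> g p v w = 0) \<Longrightarrow> v = 0"
  using semi_riemannian unfolding semi_riemannian_metric_def by auto

lemma g_linear: "v \<in> tangent_space A p \<Longrightarrow> linear_between (tangent_space A p) UNIV (g p v)"
  and g_linear_left: "v \<in> tangent_space A p \<Longrightarrow> linear_between (tangent_space A p) UNIV (\<lambda>w. g p w v)"
  using g_bilinear_field unfolding smooth_bilinear_field_def by auto

lemma G_smooth: "X \<in> vector_fields A \<Longrightarrow> Y \<in> vector_fields A \<Longrightarrow> G X Y \<in> smooth_functions A"
  using g_bilinear_field unfolding smooth_bilinear_field_def by auto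

lemma G_sym: "X \<in> vector_fields A \<Longrightarrow> Y \<in> vector_fields A \<Longrightarrow> G X Y = G Y X"
  by (auto simp: app_bilinear_def fun_eq_iff intro!: g_sym vector_fieldsD)

lemma G_add_right: "X \<in> vector_fields A \<Longrightarrow> Y \<in> vector_fields A \<Longrightarrow> Z \<in> vector_fields A \<Longrightarrow>
    G X (Y + Z) = G X Y + G X Z"
  using linear_between_add[OF g_linear, OF vector_fieldsD(1) vector_fieldsD(1) vector_fieldsD(1)]
  by (auto simp: app_bilinear_def fun_eq_iff plus_fun_def)

lemma G_scaleR_right: "X \<in> vector_fields A \<Longrightarrow> Y \<in> vector_fields A \<Longrightarrow> G X (c *\<^sub>R Y) = c *\<^sub>R G X Y"
  using linear_between_scaleR[OF g_linear, OF vector_fieldsD(1) vector_fieldsD(1)]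
  by (auto simp: app_bilinear_def fun_eq_iff scaleR_fun_def)

lemma G_diff_right: "X \<in> vector_fields A \<Longrightarrow> Y \<in> vector_fields A \<Longrightarrow> Z \<in> vector_fields A \<Longrightarrow>
    G X (Y - Z) = G X Y - G X Z"
  using G_add_right[of X Y "- 1 *\<^sub>R Z"] G_scaleR_right[of X Z "- 1"] vector_fields_scaleR[of Z "- 1"]
  by simp

lemma G_diff_left: "X \<in> vector_fields A \<Longrightarrow> Y \<in> vector_fields A \<Longrightarrow> Z \<in> vector_fields A \<Longrightarrow>
    G (Y - Z) X = G Y X - G Z X"
  using G_diff_right[of X Y Z] G_sym vector_fields_diff by simp

text \<open>Testing against vector fields is as good as testing against tangent vectors, because every tangent
  vector extends.\<close>

lemma G_separates:
  assumes X: "X \<in> vector_fields A" and Y: "Y \<in> vector_fields A"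
    and eq: "\<And>W. W \<in> vector_fields A \<Longrightarrow> G X W p = G Y W p"
  shows "X p = Y p"
proof -
  have "g p (X p - Y p) w = 0" if w: "w \<in> tangent_space A p" for w
  proof -
    obtain W where W: "W \<in> vector_fields A" "W p = w"
      using vector_field_extension[OF w] by blast
    show ?thesis
      using linear_between_diff[OF g_linear_left[OF w] tangent_space_subspace
          vector_fieldsD(1)[OF X] vector_fieldsD(1)[OF Y]] eq[OF W(1)] W(2)
      by (simp add: app_bilinear_def)
  qed
  with subspace_diff[OF tangent_space_subspace vector_fieldsD(1)[OF X] vector_fieldsD(1)[OF Y]]
  have "X p - Y p = 0" by (rule g_nondegenerate)
  then show ?thesis by simp
qed

lemma affine: "affine_connection A D"
  and torsion_free: "X \<in> vector_fields A \<Longrightarrow> Y \<in> vector_fields A \<Longrightarrow> D X Y - D Y X = lie_bracket X Y"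
  and metric_derivative: "X \<in> vector_fields A \<Longrightarrow> Y \<in> vector_fields A \<Longrightarrow> Z \<in> vector_fields A \<Longrightarrow>
    vderiv X (G Y Z) = G (D X Y) Z + G Y (D X Z)"
  using connection unfolding levi_civita_connection_def by auto

lemma D_mem: "X \<in> vector_fields A \<Longrightarrow> Y \<in> vector_fields A \<Longrightarrow> D X Y \<in> vector_fields A"
  and D_add_right: "X \<in> vector_fields A \<Longrightarrow> Y \<in> vector_fields A \<Longrightarrow> Y' \<in> vector_fields A \<Longrightarrow>
    D X (Y + Y') = D X Y + D X Y'"
  and D_scaleR_right: "X \<in> vector_fields A \<Longrightarrow> Y \<in> vector_fields A \<Longrightarrow> D X (c *\<^sub>R Y) = c *\<^sub>R D X Y"
  and D_fmul_left: "X \<in> vector_fields A \<Longrightarrow> Y \<in> vector_fields A \<Longrightarrow> f \<in> smooth_functions A \<Longrightarrow>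
    D (f \<odot> X) Y = f \<odot> D X Y"
  using affine unfolding affine_connection_def by simp_all

lemma D_diff_right: "X \<in> vector_fields A \<Longrightarrow> Y \<in> vector_fields A \<Longrightarrow> Y' \<in> vector_fields A \<Longrightarrow>
    D X (Y - Y') = D X Y - D X Y'"
  using D_add_right[of X Y "- 1 *\<^sub>R Y'"] D_scaleR_right[of X Y' "- 1"] vector_fields_scaleR[of Y' "- 1"]
  by simp

lemma D_minus_left:
  assumes "X \<in> vector_fields A" "Y \<in> vector_fields A" shows "D (- X) Y = - D X Y"
  using D_fmul_left[OF assms smooth_functions_const[of "- 1"]]
  by (simp add: scaleR_eq_fmul[symmetric])

lemmas field_intros = D_mem vector_fields_lie_bracket vector_fields_diff vector_fields_add
  vector_fields_scaleR

lemma curvature_mem: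
  "X \<in> vector_fields A \<Longrightarrow> Y \<in> vector_fields A \<Longrightarrow> Z \<in> vector_fields A \<Longrightarrow> R X Y Z \<in> vector_fields A"
  unfolding curvature_def by (intro field_intros)

lemma curvature_skew:
  assumes "X \<in> vector_fields A" "Y \<in> vector_fields A" "Z \<in> vector_fields A"
  shows "R Y X Z = - R X Y Z"
proof -
  have "lie_bracket Y X = - lie_bracket X Y"
    by (simp add: lie_bracket_def fun_eq_iff)
  then show ?thesis
    using D_minus_left[OF vector_fields_lie_bracket[OF assms(1,2)] assms(3)]
    by (simp add: curvature_def)
qed

lemma curvature_add:
  assumes "X \<in> vector_fields A" "Y \<in> vector_fields A" "Z \<in> vector_fields A" "Z' \<in> vector_fields A"
  shows "R X Y (Z + Z') = R X Y Z + R X Y Z'"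
  using assms by (simp add: curvature_def D_add_right field_intros)

lemma curvature_scaleR:
  assumes "X \<in> vector_fields A" "Y \<in> vector_fields A" "Z \<in> vector_fields A"
  shows "R X Y (c *\<^sub>R Z) = c *\<^sub>R R X Y Z"
  using assms by (simp add: curvature_def D_scaleR_right field_intros scaleR_diff_right)

text \<open>Expand both sides of \<open>[X, Y] = X Y - Y X\<close> applied to the function \<open>g(Z, W)\<close>; the mixed first-order
  terms are symmetric in \<open>X\<close> and \<open>Y\<close> and drop out.\<close>

lemma curvature_skew_adjoint:
  assumes X: "X \<in> vector_fields A" and Y: "Y \<in> vector_fields A"
    and Z: "Z \<in> vector_fields A" and W: "W \<in> vector_fields A"
  shows "G (R X Y Z) W = - G Z (R X Y W)"
proof -
  have twice: "vderiv X (vderiv Y (G Z W)) =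
      G (D X (D Y Z)) W + G (D Y Z) (D X W) + (G (D X Z) (D Y W) + G Z (D X (D Y W)))"
    if "X \<in> vector_fields A" "Y \<in> vector_fields A" for X Y
    using that Z W by (simp add: metric_derivative vderiv_add G_smooth D_mem)
  have "G (D (lie_bracket X Y) Z) W + G Z (D (lie_bracket X Y) W) =
      vderiv X (vderiv Y (G Z W)) - vderiv Y (vderiv X (G Z W))"
    unfolding vderiv_lie_bracket[symmetric]
    by (intro metric_derivative[symmetric] vector_fields_lie_bracket X Y Z W)
  also have "\<dots> = G (D X (D Y Z)) W + G Z (D X (D Y W)) - (G (D Y (D X Z)) W + G Z (D Y (D X W)))"
    unfolding twice[OF X Y] twice[OF Y X] by simp
  finally have *: "G (D (lie_bracket X Y) Z) W + G Z (D (lie_bracket X Y) W) = \<dots>" .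
  have "G (R X Y Z) W = G (D X (D Y Z)) W - G (D Y (D X Z)) W - G (D (lie_bracket X Y) Z) W"
    using X Y Z W by (simp add: curvature_def G_diff_left field_intros)
  moreover have "G Z (R X Y W) = G Z (D X (D Y W)) - G Z (D Y (D X W)) - G Z (D (lie_bracket X Y) W)"
    using X Y Z W by (simp add: curvature_def G_diff_right field_intros)
  ultimately have "G (R X Y Z) W q = - G Z (R X Y W) q" for q
    using fun_cong[OF *, of q] by simp
  then show ?thesis by (simp add: fun_eq_iff)
qed

text \<open>Torsion-freeness turns the cyclic sum into the cyclic sum of iterated Lie brackets.\<close>

lemma bianchi:
  assumes X: "X \<in> vector_fields A" and Y: "Y \<in> vector_fields A" and Z: "Z \<in> vector_fields A"
  shows "R X Y Z + R Y Z X + R Z X Y = 0"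
proof -
  have *: "D X (D Y Z) - D X (D Z Y) - D (lie_bracket Y Z) X = lie_bracket X (lie_bracket Y Z)"
    if "X \<in> vector_fields A" "Y \<in> vector_fields A" "Z \<in> vector_fields A" for X Y Z
    using torsion_free[OF that(1) vector_fields_lie_bracket[OF that(2,3)]]
      torsion_free[OF that(2,3)] D_diff_right[OF that(1) D_mem[OF that(2,3)] D_mem[OF that(3,2)]]
    by simp
  have "R X Y Z + R Y Z X + R Z X Y =
      (D X (D Y Z) - D X (D Z Y) - D (lie_bracket Y Z) X)
      + (D Y (D Z X) - D Y (D X Z) - D (lie_bracket Z X) Y)
      + (D Z (D X Y) - D Z (D Y X) - D (lie_bracket X Y) Z)"
    unfolding curvature_def by (simp add: algebra_simps)
  also have "\<dots> = 0"
    unfolding *[OF X Y Z] *[OF Y Z X] *[OF Z X Y] by (rule jacobi[OF X Y Z])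
  finally show ?thesis .
qed

text \<open>The classical octahedron argument: add the cyclic identities on two of the four faces and subtract
  the other two.\<close>

lemma curvature_pair:
  assumes X: "X \<in> vector_fields A" and Y: "Y \<in> vector_fields A"
    and Z: "Z \<in> vector_fields A" and W: "W \<in> vector_fields A"
  shows "G (R X Y Z) W p = G (R Z W X) Y p"
proof -
  define K where "K a b c d = G (R a b c) d p" for a b c d
  have skew12: "K b a c d = - K a b c d" if "{a, b, c, d} \<subseteq> vector_fields A" for a b c d
  proof -
    have mem: "R a b c \<in> vector_fields A" "R b a c \<in> vector_fields A" "d \<in> vector_fields A"
      using that by (auto intro: curvature_mem)
    have "R b a c = - 1 *\<^sub>R R a b c" using that curvature_skew[of a b c] by simp
    then have "G d (R b a c) = - 1 *\<^sub>R G d (R a b c)"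
      using G_scaleR_right[OF mem(3,1), of "- 1"] by (simp only:)
    then show ?thesis using G_sym[OF _ mem(3)] mem by (simp add: K_def)
  qed
  have skew34: "K a b d c = - K a b c d" if "{a, b, c, d} \<subseteq> vector_fields A" for a b c d
    using that curvature_skew_adjoint[of a b c d] G_sym[OF curvature_mem, of a b d c]
    by (simp add: K_def)
  have bia: "K a b c d + K b c a d + K c a b d = 0" if "{a, b, c, d} \<subseteq> vector_fields A" for a b c d
  proof -
    have mem: "R a b c \<in> vector_fields A" "R b c a \<in> vector_fields A" "R c a b \<in> vector_fields A"
      "d \<in> vector_fields A"
      using that by (auto intro: curvature_mem)
    have "G d (R a b c + R b c a + R c a b) p = G d (0 *\<^sub>R d) p"
      using bianchi[of a b c] that by simp
    also have "\<dots> = 0" using G_scaleR_right[OF mem(4,4), of 0] by simp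
    finally have "G d (R a b c) p + G d (R b c a) p + G d (R c a b) p = 0"
      using mem by (simp add: G_add_right vector_fields_add)
    then show ?thesis using G_sym[OF _ mem(4)] mem by (simp add: K_def)
  qed
  have mem: "{X, Y, Z, W} \<subseteq> vector_fields A" using X Y Z W by simp
  have "K X Y Z W = K Z W X Y"
    using bia[of X Y Z W] bia[of Y Z W X] bia[of Z W X Y] bia[of W X Y Z]
      skew34[of Y Z X W] skew34[of X Y Z W] skew34[of Z W Y X] skew34[of W X Z Y]
      skew12[of Z X Y W] skew34[of X Z Y W] skew12[of W Y Z X] skew34[of Y W Z X] mem
    by simp
  then show ?thesis by (simp add: K_def)
qed

text \<open>The first argument can be moved into the metric, which is pointwise by definition; skew symmetry handles the second argument and pair symmetry
  the third.\<close>

lemma curvature_pointwise: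
  assumes X: "X \<in> vector_fields A" "X' \<in> vector_fields A" "X p = X' p"
    and Y: "Y \<in> vector_fields A" "Y' \<in> vector_fields A" "Y p = Y' p"
    and Z: "Z \<in> vector_fields A" "Z' \<in> vector_fields A" "Z p = Z' p"
  shows "R X Y Z p = R X' Y' Z' p"
proof -
  have first: "R X Y Z p = R X' Y Z p"
    if "X \<in> vector_fields A" "X' \<in> vector_fields A" "X p = X' p"
      "Y \<in> vector_fields A" "Z \<in> vector_fields A" for X X' Y Z
  proof (rule G_separates)
    fix W assume W: "W \<in> vector_fields A"
    show "G (R X Y Z) W p = G (R X' Y Z) W p"
      unfolding curvature_pair[OF that(1,4,5) W] curvature_pair[OF that(2,4,5) W]
        curvature_skew_adjoint[OF that(5) W that(1,4)] curvature_skew_adjoint[OF that(5) W that(2,4)]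
      using that(3) by (simp add: app_bilinear_def)
  qed (use that in \<open>auto intro: curvature_mem\<close>)
  have "R X Y Z p = R X' Y Z p" by (rule first[OF X Y(1) Z(1)])
  also have "\<dots> = R X' Y' Z p"
    using first[OF Y X(2) Z(1)] curvature_skew[OF _ X(2) Z(1)] Y by simp
  also have "\<dots> = R X' Y' Z' p"
  proof (rule G_separates)
    fix W assume W: "W \<in> vector_fields A"
    show "G (R X' Y' Z) W p = G (R X' Y' Z') W p"
      unfolding curvature_pair[OF X(2) Y(2) Z(1) W] curvature_pair[OF X(2) Y(2) Z(2) W]
      using first[OF Z W X(2)] by (simp add: app_bilinear_def)
  qed (use X Y Z in \<open>auto intro: curvature_mem\<close>)
  finally show ?thesis .
qed

text \<open>The same choice as in \<^const>\<open>at_point\<close>, so that Ricci traces refer to it literally.\<close>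

definition extend :: "'a \<Rightarrow> 'a tvec \<Rightarrow> 'a vfield"
  where "extend p v = (SOME X. X \<in> vector_fields A \<and> X p = v)"

lemma extend:
  assumes "v \<in> tangent_space A p"
  shows "extend p v \<in> vector_fields A" "extend p v p = v"
  using someI_ex[of "\<lambda>X. X \<in> vector_fields A \<and> X p = v"] vector_field_extension[OF assms]
  unfolding extend_def by blast+

definition curvature_at :: "'a \<Rightarrow> 'a tvec \<Rightarrow> 'a tvec \<Rightarrow> 'a tvec \<Rightarrow> 'a tvec"
  where "curvature_at p x y z = R (extend p x) (extend p y) (extend p z) p"

lemma curvature_eq_curvature_at:
  assumes "X \<in> vector_fields A" "Y \<in> vector_fields A" "Z \<in> vector_fields A"
  shows "R X Y Z p = curvature_at p (X p) (Y p) (Z p)"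
  unfolding curvature_at_def using assms by (intro curvature_pointwise) (simp_all add: extend vector_fieldsD)

lemma ricci_eq_trace:
  assumes "Y \<in> vector_fields A" "Z \<in> vector_fields A"
  shows "ricci A D Y Z p = trace_on (tangent_space A p) (\<lambda>x. curvature_at p x (Y p) (Z p))"
proof -
  obtain F where F: "finite F" "tangent_space A p \<subseteq> span F"
    using tangent_space_dim_le by blast
  have "at_point A (\<lambda>X. R X Y Z) p x = curvature_at p x (Y p) (Z p)" if "x \<in> tangent_space A p" for x
    using curvature_eq_curvature_at[OF extend(1)[OF that] assms] extend(2)[OF that]
    by (simp add: at_point_def extend_def)
  then show ?thesis
    unfolding ricci_def by (rule trace_on_cong[OF tangent_space_subspace F])
qed

lemma curvature_at_linear:
  assumes x: "x \<in> tangent_space A p" and y: "y \<in> tangent_space A p"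
  shows "linear_between (tangent_space A p) (tangent_space A p) (curvature_at p x y)"
proof -
  let ?X = "extend p x" and ?Y = "extend p y"
  note xy = extend[OF x] extend[OF y]
  have eq: "curvature_at p x y (Z p) = R ?X ?Y Z p" if "Z \<in> vector_fields A" for Z
    using curvature_eq_curvature_at[OF xy(1,3) that] xy by simp
  show ?thesis
    unfolding linear_between_def
  proof (intro conjI ballI allI)
    show "curvature_at p x y ` tangent_space A p \<subseteq> tangent_space A p"
      unfolding curvature_at_def
      by (intro image_subsetI vector_fieldsD(1)[OF curvature_mem[OF xy(1,3)]] extend(1))
  next
    fix v w assume "v \<in> tangent_space A p" "w \<in> tangent_space A p"
    note vw = extend[OF this(1)] extend[OF this(2)]
    show "curvature_at p x y (v + w) = curvature_at p x y v + curvature_at p x y w"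
      using eq[OF vector_fields_add[OF vw(1,3)]] eq[OF vw(1)] eq[OF vw(3)] vw
        curvature_add[OF xy(1,3) vw(1,3)] by simp
  next
    fix c v assume "v \<in> tangent_space A p"
    note v = extend[OF this]
    show "curvature_at p x y (c *\<^sub>R v) = c *\<^sub>R curvature_at p x y v"
      using eq[OF vector_fields_scaleR[OF v(1), of c]] eq[OF v(1)] v
        curvature_scaleR[OF xy(1,3) v(1)] by simp
  qed
qed

end

section \<open>Curvature of para Sasakian manifolds\<close>

context eps_para_sasakian_manifold
begin

sublocale levi_civita_manifold A g D
  by unfold_locales (rule metric levi_civita)+

abbreviation \<Phi> where "\<Phi> \<equiv> app_endo \<phi>"
abbreviation H where "H \<equiv> app_form \<eta>"

lemma eps_mult_eps: "\<epsilon> * \<epsilon> = 1"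
  using eps by auto

lemma Phi_mem: "X \<in> vector_fields A \<Longrightarrow> \<Phi> X \<in> vector_fields A"
  using phi_smooth unfolding smooth_endo_field_def by blast

lemma phi_linear: "linear_between (tangent_space A p) (tangent_space A p) (\<phi> p)"
  using phi_smooth unfolding smooth_endo_field_def by blast

lemma eta_linear: "linear_between (tangent_space A p) UNIV (\<eta> p)"
  using eta_smooth unfolding smooth_one_form_def by blast

lemma Phi_scaleR: "X \<in> vector_fields A \<Longrightarrow> \<Phi> (c *\<^sub>R X) = c *\<^sub>R \<Phi> X"
  using linear_between_scaleR[OF phi_linear vector_fieldsD(1)]
  by (simp add: app_endo_def fun_eq_iff scaleR_fun_def)

lemma Phi_diff: "X \<in> vector_fields A \<Longrightarrow> Y \<in> vector_fields A \<Longrightarrow> \<Phi> (X - Y) = \<Phi> X - \<Phi> Y"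
  using linear_between_diff[OF phi_linear tangent_space_subspace vector_fieldsD(1) vector_fieldsD(1)]
  by (simp add: app_endo_def fun_eq_iff)

lemma G_zero_right: "X \<in> vector_fields A \<Longrightarrow> G X 0 = 0"
  using G_scaleR_right[of X X 0] by simp

lemma G_xi:
  assumes "X \<in> vector_fields A" shows "G X \<xi> = \<epsilon> *\<^sub>R H X"
  using metric_compatible[OF assms xi_smooth] G_zero_right[OF Phi_mem[OF assms]]
  by (simp add: phi_xi eta_xi fun_eq_iff)

lemma eta_D_xi:
  assumes X: "X \<in> vector_fields A" shows "H (D X \<xi>) = 0"
proof -
  have mem: "D X \<xi> \<in> vector_fields A" by (intro D_mem X xi_smooth)
  have "G \<xi> \<xi> = (\<lambda>p. \<epsilon>)"
    by (simp add: G_xi[OF xi_smooth] eta_xi fun_eq_iff)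
  then have "0 = G (D X \<xi>) \<xi> + G \<xi> (D X \<xi>)"
    using metric_derivative[OF X xi_smooth xi_smooth] vderiv_const[OF X] by simp
  then have "0 = \<epsilon> *\<^sub>R H (D X \<xi>) + \<epsilon> *\<^sub>R H (D X \<xi>)"
    unfolding G_sym[OF xi_smooth mem] G_xi[OF mem] .
  from fun_cong[OF this] have "\<epsilon> * H (D X \<xi>) p = 0" for p by simp
  moreover have "\<epsilon> \<noteq> 0" using eps by auto
  ultimately show ?thesis by (simp add: fun_eq_iff)
qed

text \<open>Putting \<open>Y = \<xi>\<close> in the para Sasakian equation gives \<open>\<phi> (D X \<xi>) = \<epsilon> \<phi>\<^sup>2 X\<close>. Applying \<open>\<phi>\<close> once
  more recovers \<open>D X \<xi>\<close>, because \<open>\<phi>\<^sup>2\<close> is the identity on the kernel of \<open>\<eta>\<close> and \<open>D X \<xi>\<close> lies in it,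
  the length of \<open>\<xi>\<close> being constant.\<close>

lemma D_xi:
  assumes X: "X \<in> vector_fields A" shows "D X \<xi> = \<epsilon> *\<^sub>R \<Phi> X"
proof -
  have mem: "D X \<xi> \<in> vector_fields A" by (intro D_mem X xi_smooth)
  have "D X (0 :: 'a vfield) = 0"
    using D_scaleR_right[OF X X, of 0] by simp
  then have "- \<Phi> (D X \<xi>) = - (G (\<Phi> X) 0 \<odot> \<xi>) - \<epsilon> *\<^sub>R ((\<lambda>p. 1) \<odot> \<Phi> (\<Phi> X))"
    using para_sasakian[OF X xi_smooth] by (simp add: phi_xi eta_xi)
  moreover have "G (\<Phi> X) 0 \<odot> \<xi> = 0"
    by (simp add: G_zero_right[OF Phi_mem[OF X]] fmul_def fun_eq_iff)
  moreover have "(\<lambda>p. 1) \<odot> \<Phi> (\<Phi> X) = \<Phi> (\<Phi> X)"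
    by (simp add: fmul_def)
  ultimately have "\<Phi> (D X \<xi>) = \<epsilon> *\<^sub>R \<Phi> (\<Phi> X)" by simp
  then have "\<Phi> (\<Phi> (D X \<xi>)) = \<epsilon> *\<^sub>R \<Phi> (\<Phi> (\<Phi> X))"
    using Phi_scaleR[OF Phi_mem[OF Phi_mem[OF X]]] by simp
  then have "D X \<xi> - 0 \<odot> \<xi> = \<epsilon> *\<^sub>R (\<Phi> X - 0 \<odot> \<xi>)"
    unfolding phi_phi[OF mem] phi_phi[OF Phi_mem[OF X]] eta_D_xi[OF X] eta_phi[OF X] .
  moreover have "0 \<odot> \<xi> = 0" by (simp add: fmul_def fun_eq_iff)
  ultimately show ?thesis by simp
qed

text \<open>By \<open>D_xi\<close> the curvature on \<open>\<xi>\<close> is \<open>\<epsilon>\<close> times the skew part of \<open>(D X \<phi>) Y\<close>; there the metric terms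
  cancel by symmetry.\<close>

lemma curvature_xi:
  assumes X: "X \<in> vector_fields A" and Y: "Y \<in> vector_fields A"
  shows "R X Y \<xi> p = \<eta> p (X p) *\<^sub>R Y p - \<eta> p (Y p) *\<^sub>R X p"
proof -
  have "R X Y \<xi> = \<epsilon> *\<^sub>R ((D X (\<Phi> Y) - \<Phi> (D X Y)) - (D Y (\<Phi> X) - \<Phi> (D Y X)))"
    unfolding curvature_def torsion_free[OF X Y, symmetric] using X Y
    by (simp add: D_xi Phi_diff D_scaleR_right field_intros Phi_mem scaleR_diff_right)
  also have "\<dots> = \<epsilon> *\<^sub>R (\<epsilon> *\<^sub>R (H X \<odot> \<Phi> (\<Phi> Y)) - \<epsilon> *\<^sub>R (H Y \<odot> \<Phi> (\<Phi> X)))"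
    unfolding para_sasakian[OF X Y] para_sasakian[OF Y X] G_sym[OF Phi_mem[OF Y] Phi_mem[OF X]]
    by simp
  also have "\<dots> = H X \<odot> \<Phi> (\<Phi> Y) - H Y \<odot> \<Phi> (\<Phi> X)"
    using eps_mult_eps by (simp add: scaleR_diff_right)
  also have "\<dots> = H X \<odot> (Y - H Y \<odot> \<xi>) - H Y \<odot> (X - H X \<odot> \<xi>)"
    unfolding phi_phi[OF X] phi_phi[OF Y] ..
  finally show ?thesis
    by (simp add: fmul_def app_form_def scaleR_diff_right mult.commute)
qed

lemma curvature_tensor_at:
  assumes "DIM('e) \<le> 3"
  shows "para_sasakian_curvature_tensor (tangent_space A p) (g p) (\<xi> p) (\<eta> p) \<epsilon> (curvature_at p)"
proof
  let ?T = "tangent_space A p"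
  show "subspace ?T" by (rule tangent_space_subspace)
  show "\<exists>F. finite F \<and> card F \<le> 3 \<and> ?T \<subseteq> span F"
    using tangent_space_dim_le[of p] assms by (meson le_trans)
  show "\<xi> p \<in> ?T" by (rule vector_fieldsD(1)[OF xi_smooth])
  show "linear_between ?T UNIV (\<eta> p)" by (rule eta_linear)
  show "\<eta> p (\<xi> p) = 1" using eta_xi by (simp add: app_form_def fun_eq_iff)
  show "\<epsilon> * \<epsilon> = 1" by (rule eps_mult_eps)
  fix x y assume x: "x \<in> ?T" and y: "y \<in> ?T"
  note X = extend[OF x] and Y = extend[OF y]
  show "linear_between ?T UNIV (g p x)" by (rule g_linear[OF x])
  show "g p x y = g p y x" by (rule g_sym[OF x y])
  show "g p x (\<xi> p) = \<epsilon> * \<eta> p x"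
    using fun_cong[OF G_xi[OF X(1)], of p] X(2) by (simp add: app_bilinear_def app_form_def)
  show "linear_between ?T ?T (curvature_at p x y)" by (rule curvature_at_linear[OF x y])
  show "curvature_at p x y (\<xi> p) = \<eta> p x *\<^sub>R y - \<eta> p y *\<^sub>R x"
    using curvature_eq_curvature_at[OF X(1) Y(1) xi_smooth, of p] curvature_xi[OF X(1) Y(1), of p] X(2) Y(2)
    by simp
  fix z assume z: "z \<in> ?T"
  note Z = extend[OF z]
  show "curvature_at p y x z = - curvature_at p x y z"
    unfolding curvature_at_def curvature_skew[OF X(1) Y(1) Z(1)] by simp
  fix w assume w: "w \<in> ?T"
  note W = extend[OF w]
  show "g p (curvature_at p x y z) w = - g p z (curvature_at p x y w)"
    using fun_cong[OF curvature_skew_adjoint[OF X(1) Y(1) Z(1) W(1)], of p] Z(2) W(2)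
    by (simp add: curvature_at_def app_bilinear_def)
  show "g p (curvature_at p x y z) w = g p (curvature_at p z w x) y"
    using curvature_pair[OF X(1) Y(1) Z(1) W(1), of p] Y(2) W(2)
    by (simp add: curvature_at_def app_bilinear_def)
next
  fix x assume "x \<in> tangent_space A p" "\<And>y. y \<in> tangent_space A p \<Longrightarrow> g p x y = 0"
  then show "x = 0" by (rule g_nondegenerate)
qed

theorem ricci_semi_symmetric_imp_space_form:
  assumes dim: "DIM('e) \<le> 3" and semi: "ricci_semi_symmetric A D"
  shows "indefinite_space_form A g D"
  unfolding indefinite_space_form_def
proof (intro exI[of _ "- \<epsilon>"] ballI ext)
  fix X Y Z p
  assume X: "X \<in> vector_fields A" and Y: "Y \<in> vector_fields A" and Z: "Z \<in> vector_fields A"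
  interpret P: para_sasakian_curvature_tensor "tangent_space A p" "g p" "\<xi> p" "\<eta> p" \<epsilon> "curvature_at p"
    by (rule curvature_tensor_at[OF dim])
  have "P.S (curvature_at p x y u) v + P.S u (curvature_at p x y v) = 0"
    if "x \<in> tangent_space A p" "y \<in> tangent_space A p" "u \<in> tangent_space A p" "v \<in> tangent_space A p"
    for x y u v
  proof -
    note x = extend[OF that(1)] and y = extend[OF that(2)] and u = extend[OF that(3)] and v = extend[OF that(4)]
    have "ricci A D (R (extend p x) (extend p y) (extend p u)) (extend p v)
        + ricci A D (extend p u) (R (extend p x) (extend p y) (extend p v)) = 0"
      using semi x y u v unfolding ricci_semi_symmetric_def by blast
    from fun_cong[OF this, of p] show ?thesis
      using ricci_eq_trace[OF curvature_mem[OF x(1) y(1) u(1)] v(1)]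
        ricci_eq_trace[OF u(1) curvature_mem[OF x(1) y(1) v(1)]] u(2) v(2)
      by (simp add: P.S_def curvature_at_def)
  qed
  from P.constant_curvature[OF this vector_fieldsD(1)[OF X] vector_fieldsD(1)[OF Y] vector_fieldsD(1)[OF Z]]
  have "R X Y Z p = (- \<epsilon>) *\<^sub>R (g p (Y p) (Z p) *\<^sub>R X p - g p (X p) (Z p) *\<^sub>R Y p)"
    unfolding curvature_eq_curvature_at[OF X Y Z] .
  also have "\<dots> = ((- \<epsilon>) *\<^sub>R (G Y Z \<odot> X - G X Z \<odot> Y)) p"
    by (simp add: fmul_def app_bilinear_def)
  finally show "R X Y Z p f = ((- \<epsilon>) *\<^sub>R (G Y Z \<odot> X - G X Z \<odot> Y)) p f" for f by simp
qed

end

theorem theorem3p1: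
  fixes A :: "('a::{t2_space,second_countable_topology}, real^3) atlas"
    and \<phi> :: "'a endo_field"
    and \<xi> :: "'a vfield"
    and \<eta> :: "'a one_form"
    and g :: "'a bilinear_field"
    and \<epsilon> :: real
    and D :: "'a connection"
  assumes "eps_para_sasakian_manifold A \<phi> \<xi> \<eta> g \<epsilon> D"
    and "ricci_semi_symmetric A D"
  shows "indefinite_space_form A g D"
  using eps_para_sasakian_manifold.ricci_semi_symmetric_imp_space_form[OF assms(1) _ assms(2)]
  by simp

end
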